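(* Let $(X,d,\nu)$ be a measured length space satisfying $PL(K)$ for some $K>0$. Then the transportation inequality $T_2(K)$ holds true: for every $\mu\in P_2(X)$, $$W_2(\mu,\nu)^2\leq\frac{2}{K}H_\nu(\mu).$$
   Context: A length space is a metric space $(X,d)$ in which the distance between two points is the infimum of the lengths of curves joining them. A measured length space $(X,d,\nu)$ is a length space with a Borel probability measure $\nu$. For $x,y\in X$ and $t\in[0,1]$, $Z_t(x,y)$ is the set of $z\in X$ with $d(x,z)=t\,d(x,y)$ and $d(z,y)=(1-t)\,d(x,y)$. $(X,d,\nu)$ satisfies the Prékopa-Leindler inequality $PL(K)$, $K\in\mathbb{R}$, if for every $t\in[0,1]$ and every triple of functions $u,v,w\in L^1(X,\mathbb{R}_+^* )$ (strictly positive, $\nu$-integrable) satisfying $$u(x)^{1-t}v(y)^t\exp\left(-K\frac{t(1-t)}{2}d(x,y)^2\right)\leq w(z)\quad\text{for all }x,y\in X,\ z\in Z_t(x,y),$$ one has $$\left(\int_X u\,d\nu\right)^{1-t}\left(\int_X v\,d\nu\right)^t\leq\int_X w\,d\nu.$$ $P_2(X)$ is the set of Borel probability measures on $X$ with finite second moment. The Wasserstein distance is $$W_2(\mu_0,\mu_1)^2=\inf_{\pi\in\Pi(\mu_0,\mu_1)}\int_{X\times X}d(x_0,x_1)^2\,d\pi(x_0,x_1),$$ where $\Pi(\mu_0,\mu_1)$ is the set of probability measures on $X\times X$ with first and second marginals $\mu_0$ and $\mu_1$. The relative entropy is $H_\nu(\mu)=\int_X\rho\log\rho\,d\nu$ if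 $\mu=\rho\nu$ is absolutely continuous with respect to $\nu$, and $H_\nu(\mu)=+\infty$ otherwise. *)

theory Defs
  imports "HOL-Analysis.Analysis" "HOL-Probability.Probability"
begin

text \<open>The metric space \<open>X\<close> is the universe of an arbitrary type of class \<open>metric_space\<close>; neither
  separability nor completeness is assumed.\<close>

definition curve_length :: "(real \<Rightarrow> 'a::metric_space) \<Rightarrow> ennreal" where
  "curve_length \<gamma> =
     (SUP (n, s) \<in> {(n::nat, s::nat \<Rightarrow> real). mono_on {..n} s \<and> s ` {..n} \<subseteq> {0..1}}.
        \<Sum>i<n. ennreal (dist (\<gamma> (s i)) (\<gamma> (s (Suc i)))))"

definition length_space :: "'a::metric_space itself \<Rightarrow> bool" where
  "length_space _ \<longleftrightarrow>
     (\<forall>x y::'a. ennreal (dist x y) =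
        (INF \<gamma> \<in> {\<gamma>. path \<gamma> \<and> pathstart \<gamma> = x \<and> pathfinish \<gamma> = y}. curve_length \<gamma>))"

definition borel_prob :: "'a::topological_space measure \<Rightarrow> bool" where
  "borel_prob \<mu> \<longleftrightarrow> sets \<mu> = sets borel \<and> prob_space \<mu>"

definition measured_length_space :: "'a::metric_space measure \<Rightarrow> bool" where
  "measured_length_space \<nu> \<longleftrightarrow> length_space TYPE('a) \<and> borel_prob \<nu>"

definition Z :: "real \<Rightarrow> 'a::metric_space \<Rightarrow> 'a \<Rightarrow> 'a set" where
  "Z t x y = {z. dist x z = t * dist x y \<and> dist z y = (1 - t) * dist x y}"

definition PL :: "real \<Rightarrow> 'a::metric_space measure \<Rightarrow> bool" where
  "PL K \<nu> \<longleftrightarrow>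
     (\<forall>t\<in>{0..1}. \<forall>u v w :: 'a \<Rightarrow> real.
        integrable \<nu> u \<and> integrable \<nu> v \<and> integrable \<nu> w \<and>
        (\<forall>x. 0 < u x) \<and> (\<forall>x. 0 < v x) \<and> (\<forall>x. 0 < w x) \<and>
        (\<forall>x y. \<forall>z\<in>Z t x y.
           u x powr (1 - t) * v y powr t * exp (- K * (t * (1 - t) / 2) * (dist x y)\<^sup>2) \<le> w z)
        \<longrightarrow> (LINT x|\<nu>. u x) powr (1 - t) * (LINT x|\<nu>. v x) powr t \<le> (LINT x|\<nu>. w x))"

definition P2 :: "'a::metric_space measure set" where
  "P2 = {\<mu>. borel_prob \<mu> \<and> (\<exists>x\<^sub>0. integrable \<mu> (\<lambda>x. (dist x\<^sub>0 x)\<^sup>2))}"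

text \<open>Couplings live on the product \<open>\<sigma>\<close>-algebra of \<open>X \<times> X\<close>. If the marginals are carried by
  separable closed sets (in particular if \<open>X\<close> is separable), then every coupling is carried by
  the product of these sets, on which this \<open>\<sigma>\<close>-algebra is the Borel one. Only outside that case
  can the squared distance fail to be measurable; \<open>nn_integral\<close> is then the lower integral.\<close>

definition couplings :: "'a::metric_space measure \<Rightarrow> 'a measure \<Rightarrow> ('a \<times> 'a) measure set" where
  "couplings \<mu>\<^sub>0 \<mu>\<^sub>1 =
     {\<pi>. sets \<pi> = sets (borel \<Otimes>\<^sub>M borel) \<and> prob_space \<pi> \<and>
         distr \<pi> borel fst = \<mu>\<^sub>0 \<and> distr \<pi> borel snd = \<mu>\<^sub>1}"

definition transport_cost :: "'a::metric_space measure \<Rightarrow> 'a measure \<Rightarrow> ennreal" where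
  "transport_cost \<mu>\<^sub>0 \<mu>\<^sub>1 =
     (INF \<pi> \<in> couplings \<mu>\<^sub>0 \<mu>\<^sub>1. \<integral>\<^sup>+ p. ennreal ((dist (fst p) (snd p))\<^sup>2) \<partial>\<pi>)"

definition W2 :: "'a::metric_space measure \<Rightarrow> 'a measure \<Rightarrow> ennreal" where
  "W2 \<mu>\<^sub>0 \<mu>\<^sub>1 =
     (if transport_cost \<mu>\<^sub>0 \<mu>\<^sub>1 = \<top> then \<top>
      else ennreal (sqrt (enn2real (transport_cost \<mu>\<^sub>0 \<mu>\<^sub>1))))"

lemma W2_squared: "(W2 \<mu>\<^sub>0 \<mu>\<^sub>1)\<^sup>2 = transport_cost \<mu>\<^sub>0 \<mu>\<^sub>1"
  by (cases "transport_cost \<mu>\<^sub>0 \<mu>\<^sub>1")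
     (auto simp: W2_def ennreal_power power2_eq_square ennreal_top_mult simp flip: ennreal_mult)

text \<open>The negative part of \<open>\<rho> ln \<rho>\<close> is at most \<open>1/e\<close>, so the difference below is never of the
  form \<open>\<infinity> - \<infinity>\<close>. The library's \<open>KL_divergence\<close> is not used because it is \<open>0\<close>, not \<open>\<infinity>\<close>, when
  \<open>\<rho> ln \<rho>\<close> fails to be integrable.\<close>

definition relative_entropy :: "'a measure \<Rightarrow> 'a measure \<Rightarrow> ereal" where
  "relative_entropy \<nu> \<mu> =
     (if absolutely_continuous \<nu> \<mu>
      then let \<rho> = (\<lambda>x. enn2real (RN_deriv \<nu> \<mu> x)) in
        enn2ereal (\<integral>\<^sup>+ x. ennreal (\<rho> x * ln (\<rho> x)) \<partial>\<nu>) -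
        enn2ereal (\<integral>\<^sup>+ x. ennreal (- (\<rho> x * ln (\<rho> x))) \<partial>\<nu>)
      else \<infinity>)"

end

theory Submission
  imports Defs
begin

text \<open>
  For \<open>w = 1\<close>, \<open>u = exp (- K t f)\<close> and \<open>v = exp (K (1 - t) g)\<close> the hypothesis of the
  Prekopa-Leindler inequality reads \<open>g y - f x \<le> d(x, y)\<^sup>2 / 2\<close>, and its conclusion turns, as
  \<open>t\<close> tends to \<open>0\<close>, into \<open>\<integral> exp (K g) d\<nu> \<le> exp (K \<integral> f d\<nu>)\<close>. With the variational formula for
  the entropy this gives \<open>K (\<integral> g d\<mu> - \<integral> f d\<nu>) \<le> H\<close> for all such pairs of bounded potentials
  (\<open>PL_dual_entropy\<close>), and the Kantorovich dual of the transport problem with cost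
  \<open>d\<^sup>2\<close> is twice the supremum of \<open>\<integral> g d\<mu> - \<integral> f d\<nu>\<close>. What remains is to pass from this bound
  on the dual problem to actual couplings of almost that cost.

  Only near-optimal couplings are needed, so the space may be cut into countably many small
  cells. On the cells the problem becomes a transport problem on the natural numbers, where
  duality follows from Farkas' lemma and a compactness argument
  (\<open>countable_transport_duality\<close>). A discrete plan is realised by mixing the products of the
  restrictions of \<open>\<mu>\<close> and \<open>\<nu>\<close> to pairs of cells (\<open>cellwise_coupling\<close>).

  The delicate point is that \<open>X\<close> may be nonseparable, and then \<open>\<nu>\<close> need not be carried by
  countably many sets of small diameter: if measurable cardinals exist, a discrete set can carry a
  diffuse probability measure. Cells are therefore allowed to be \<^emph>\<open>blocks\<close>: sets split into
  pieces of diameter at most \<open>\<epsilon>\<close> such that every union of pieces is measurable and either null or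
  of full measure. Two facts make this work. Under \<open>PL K\<close>, countably many blocks exhaust \<open>\<nu>\<close>
  (\<open>PL_block_partition\<close>): a diffuse family of separated pieces could be cut into portions of
  arbitrarily small mass, and a slight displacement of the portions towards a fixed ball would, by
  \<open>PL\<close>, produce disjoint sets of total mass larger than \<open>1\<close>. And with respect to the product
  \<open>\<sigma>\<close>-algebra a block behaves like a set of diameter \<open>\<epsilon>\<close> (\<open>block_rectangle\<close>): a product-measurable
  set on which \<open>d \<ge> c\<close> and which is not negligible forces \<open>d \<ge> c - 2 \<epsilon>\<close> on a full-measure
  rectangle. Hence the lower integral of \<open>d\<^sup>2\<close> over a pair of blocks is governed by
  the essential distance of the two blocks, which is also what the potentials in the dual
  problem see.
\<close>

section \<open>Farkas' lemma and transport duality on the natural numbers\<close>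

text \<open>
  Vectors are families of reals over an arbitrary index type, so that the number of variables
  can vary inside a proof.
\<close>

definition linear_form :: "(('k \<Rightarrow> real) \<Rightarrow> real) \<Rightarrow> bool" where
  "linear_form A \<longleftrightarrow> (\<forall>x y c. A (\<lambda>k. x k + c * y k) = A x + c * A y)"

lemma linear_form_add_scaled:
  assumes "linear_form A" "linear_form B"
  shows "linear_form (\<lambda>x. A x + c * B x)"
  using assms by (simp add: linear_form_def algebra_simps)

lemma linear_form_zero:
  assumes "linear_form A"
  shows "A (\<lambda>k. 0) = 0"
proof -
  have "A (\<lambda>k. 0 + 1 * 0) = A (\<lambda>k. 0) + 1 * A (\<lambda>k. 0)"
    using assms unfolding linear_form_def by fast
  then show ?thesis by simp
qed

text \<open>
  Bartl's induction on the number of inequalities. If the inequality \<open>A m\<close> matters, there is a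
  point \<open>x0\<close> that satisfies all the others and violates the conclusion; normalise \<open>A m x0 = -1\<close>.
  Moving any \<open>x\<close> in the direction \<open>x0\<close> until \<open>A m\<close> vanishes corresponds to replacing
  each form \<open>B\<close> by \<open>B + B x0 \<cdot> A m\<close>, and the induction hypothesis applies to these. Both signs at
  \<open>x0\<close> go the right way for the coefficient of \<open>A m\<close>.
\<close>

lemma farkas:
  assumes "finite I" "\<And>i. i \<in> I \<Longrightarrow> linear_form (A i)" "linear_form G"
    and "\<And>x. (\<And>i. i \<in> I \<Longrightarrow> 0 \<le> A i x) \<Longrightarrow> 0 \<le> G x"
  shows "\<exists>c. (\<forall>i\<in>I. 0 \<le> c i) \<and> (\<forall>x. G x = (\<Sum>i\<in>I. c i * A i x))"
  using assms
proof (induction I arbitrary: A G rule: finite_induct)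
  case empty
  have "G x = 0" for x
  proof -
    have "0 \<le> G (\<lambda>k. 0 + (-1) * x k)" using empty by blast
    also have "\<dots> = G (\<lambda>k. 0) + (-1) * G x"
      using empty unfolding linear_form_def by fast
    finally have "G x \<le> 0" using linear_form_zero[OF empty(2)] by simp
    moreover have "0 \<le> G x" using empty by blast
    ultimately show ?thesis by simp
  qed
  then show ?case by auto
next
  case (insert m I)
  have linA: "linear_form (A i)" if "i \<in> insert m I" for i
    using insert.prems(1) that by blast
  show ?case
  proof (cases "\<forall>x. (\<forall>i\<in>I. 0 \<le> A i x) \<longrightarrow> 0 \<le> G x")
    case True
    then obtain c where c: "\<forall>i\<in>I. 0 \<le> c i" "\<forall>x. G x = (\<Sum>i\<in>I. c i * A i x)"
      using insert.IH[of A G] linA insert.prems(2) by blast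
    have "(\<Sum>i\<in>I. (c(m := 0)) i * A i x) = (\<Sum>i\<in>I. c i * A i x)" for x
      using insert.hyps by (intro sum.cong) auto
    then have "\<forall>x. G x = (\<Sum>i\<in>insert m I. (c(m := 0)) i * A i x)"
      using c insert.hyps by simp
    then show ?thesis using c(1) by (intro exI[of _ "c(m := 0)"]) auto
  next
    case False
    then obtain x0' where x0': "\<forall>i\<in>I. 0 \<le> A i x0'" "G x0' < 0"
      by (auto simp: not_le)
    have neg: "A m x0' < 0"
      using insert.prems(3)[of x0'] x0' by fastforce
    define x0 where "x0 = (\<lambda>k. 0 + (- 1 / A m x0') * x0' k)"
    have scale: "B x0 = (- 1 / A m x0') * B x0'" if "linear_form B" for B
    proof -
      have "B x0 = B (\<lambda>k. 0) + (- 1 / A m x0') * B x0'"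
        using that unfolding linear_form_def x0_def by fast
      then show ?thesis using linear_form_zero[OF that] by simp
    qed
    have x0: "0 \<le> A i x0" if "i \<in> I" for i
      using scale[OF linA[of i]] that x0' neg by (simp add: divide_nonneg_neg)
    have Gx0: "G x0 < 0"
      using scale[OF insert.prems(2)] divide_neg_neg[OF x0'(2) neg] by simp
    have mx0: "A m x0 = -1"
      using scale[OF linA[of m]] neg by simp
    define A' where "A' = (\<lambda>i x. A i x + A i x0 * A m x)"
    define G' where "G' = (\<lambda>x. G x + G x0 * A m x)"
    have shift: "A i (\<lambda>k. x k + A m x * x0 k) = A i x + A m x * A i x0"
      if "i \<in> insert m I" for i x
      using linA[OF that] unfolding linear_form_def by fast
    have shiftG: "G (\<lambda>k. x k + A m x * x0 k) = G x + A m x * G x0" for x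
      using insert.prems(2) unfolding linear_form_def by fast
    have "\<exists>c. (\<forall>i\<in>I. 0 \<le> c i) \<and> (\<forall>x. G' x = (\<Sum>i\<in>I. c i * A' i x))"
    proof (rule insert.IH)
      show "linear_form (A' i)" if "i \<in> I" for i
        unfolding A'_def using that by (intro linear_form_add_scaled linA) auto
      show "linear_form G'"
        unfolding G'_def by (intro linear_form_add_scaled linA insert.prems) auto
      fix x assume x: "\<And>i. i \<in> I \<Longrightarrow> 0 \<le> A' i x"
      have "0 \<le> G (\<lambda>k. x k + A m x * x0 k)"
      proof (rule insert.prems(3))
        fix i assume i: "i \<in> insert m I"
        show "0 \<le> A i (\<lambda>k. x k + A m x * x0 k)"
          using x[of i] i mx0 unfolding shift[OF i] A'_def by (auto simp: mult.commute)
      qed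
      then show "0 \<le> G' x" unfolding shiftG G'_def by (simp add: mult.commute)
    qed
    then obtain c where c: "\<forall>i\<in>I. 0 \<le> c i" "\<And>x. G' x = (\<Sum>i\<in>I. c i * A' i x)"
      by blast
    define d where "d = (\<Sum>i\<in>I. c i * A i x0) - G x0"
    have "0 \<le> (\<Sum>i\<in>I. c i * A i x0)" using c(1) x0 by (intro sum_nonneg) auto
    then have d: "0 \<le> d" using Gx0 by (simp add: d_def)
    have "G x = (\<Sum>i\<in>insert m I. (c(m := d)) i * A i x)" for x
    proof -
      have "G x = (\<Sum>i\<in>I. c i * A' i x) - G x0 * A m x"
        using c(2)[of x] by (simp add: G'_def)
      also have "(\<Sum>i\<in>I. c i * A' i x)
          = (\<Sum>i\<in>I. c i * A i x) + (\<Sum>i\<in>I. c i * A i x0) * A m x"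
        by (simp add: A'_def algebra_simps sum.distrib sum_distrib_left)
      also have "\<dots> - G x0 * A m x = (\<Sum>i\<in>I. c i * A i x) + d * A m x"
        by (simp add: d_def algebra_simps)
      also have "(\<Sum>i\<in>I. c i * A i x) = (\<Sum>i\<in>I. (c(m := d)) i * A i x)"
        using insert.hyps by (intro sum.cong) auto
      finally show ?thesis using insert.hyps by simp
    qed
    then show ?thesis using c(1) d by (intro exI[of _ "c(m := d)"]) auto
  qed
qed

text \<open>
  Farkas' lemma in the variables \<open>\<alpha>\<close>, \<open>\<beta>\<close> and a homogenising scale \<open>s \<ge> 0\<close>, for the forms
  \<open>s C i j - \<alpha> i - \<beta> j\<close> and \<open>s\<close>: the multipliers of the former are the transport plan. For \<open>s = 0\<close>
  the required inequality follows by scaling, because \<open>C \<ge> 0\<close> makes every multiple of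
  \<open>(\<alpha>, \<beta>)\<close> feasible.
\<close>

lemma finite_transport_duality:
  fixes C :: "nat \<Rightarrow> nat \<Rightarrow> real" and p q :: "nat \<Rightarrow> real"
  assumes C: "\<And>i j. 0 \<le> C i j"
    and dual: "\<And>\<alpha> \<beta>. (\<And>i j. i \<le> n \<Longrightarrow> j \<le> n \<Longrightarrow> \<alpha> i + \<beta> j \<le> C i j) \<Longrightarrow>
                 (\<Sum>i\<le>n. \<alpha> i * p i) + (\<Sum>j\<le>n. \<beta> j * q j) \<le> V"
  obtains \<pi> where "\<And>i j. 0 \<le> \<pi> i j"
    and "\<And>i. i \<le> n \<Longrightarrow> (\<Sum>j\<le>n. \<pi> i j) = p i"
    and "\<And>j. j \<le> n \<Longrightarrow> (\<Sum>i\<le>n. \<pi> i j) = q j"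
    and "(\<Sum>i\<le>n. \<Sum>j\<le>n. C i j * \<pi> i j) \<le> V"
proof -
  let ?a = "\<lambda>i. Inl i :: nat + nat + unit"
  let ?b = "\<lambda>j. Inr (Inl j) :: nat + nat + unit"
  let ?s = "Inr (Inr ()) :: nat + nat + unit"
  define A :: "(nat \<times> nat) option \<Rightarrow> (nat + nat + unit \<Rightarrow> real) \<Rightarrow> real" where
    "A k x = (case k of None \<Rightarrow> x ?s
              | Some (i, j) \<Rightarrow> x ?s * C i j - x (?a i) - x (?b j))" for k x
  define I where "I = insert None (Some ` ({..n} \<times> {..n}))"
  define G :: "(nat + nat + unit \<Rightarrow> real) \<Rightarrow> real" where
    "G x = x ?s * V - (\<Sum>i\<le>n. x (?a i) * p i) - (\<Sum>j\<le>n. x (?b j) * q j)" for x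
  have "\<exists>c. (\<forall>k\<in>I. 0 \<le> c k) \<and> (\<forall>x. G x = (\<Sum>k\<in>I. c k * A k x))"
  proof (rule farkas)
    show "finite I" by (simp add: I_def)
    show "linear_form (A k)" for k
      by (cases k) (auto simp: A_def linear_form_def algebra_simps split: prod.split)
    show "linear_form G"
      by (auto simp: G_def linear_form_def algebra_simps sum.distrib sum_distrib_left)
    fix x assume x: "\<And>k. k \<in> I \<Longrightarrow> 0 \<le> A k x"
    have s: "0 \<le> x ?s" using x[of None] by (simp add: I_def A_def)
    have feas: "x (?a i) + x (?b j) \<le> x ?s * C i j" if "i \<le> n" "j \<le> n" for i j
      using x[of "Some (i, j)"] that by (simp add: I_def A_def)
    define X where "X = (\<Sum>i\<le>n. x (?a i) * p i) + (\<Sum>j\<le>n. x (?b j) * q j)"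
    \<comment> \<open>the dual hypothesis for the potentials multiplied by \<open>l\<close>\<close>
    have scaled: "l * X \<le> V" if l: "0 \<le> l" "l * x ?s \<le> 1" for l
    proof -
      have "(\<Sum>i\<le>n. (l * x (?a i)) * p i) + (\<Sum>j\<le>n. (l * x (?b j)) * q j) \<le> V"
      proof (rule dual)
        fix i j assume ij: "i \<le> n" "j \<le> n"
        have "l * x (?a i) + l * x (?b j) = l * (x (?a i) + x (?b j))"
          by (simp add: algebra_simps)
        also have "\<dots> \<le> l * (x ?s * C i j)"
          by (intro mult_left_mono feas ij l)
        also have "\<dots> \<le> C i j"
          using mult_right_mono[OF l(2) C[of i j]] by (simp add: mult.assoc)
        finally show "l * x (?a i) + l * x (?b j) \<le> C i j" .
      qed
      then show ?thesis
        by (simp add: X_def sum_distrib_left algebra_simps)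
    qed
    show "0 \<le> G x"
    proof (cases "x ?s = 0")
      case True
      have "X \<le> 0"
      proof (rule ccontr)
        assume "\<not> X \<le> 0"
        then have "(\<bar>V\<bar> + 1) / X * X \<le> V"
          using True by (intro scaled) auto
        then show False using \<open>\<not> X \<le> 0\<close> by simp
      qed
      then show ?thesis using True by (simp add: G_def X_def)
    next
      case False
      then have "1 / x ?s * X \<le> V" using s by (intro scaled) auto
      then have "X \<le> x ?s * V" using False s by (simp add: field_simps)
      then show ?thesis by (simp add: G_def X_def)
    qed
  qed
  then obtain c where c: "\<forall>k\<in>I. 0 \<le> c k" "\<And>x. G x = (\<Sum>k\<in>I. c k * A k x)"
    by blast
  define \<pi> where "\<pi> i j = (if i \<le> n \<and> j \<le> n then c (Some (i, j)) else 0)" for i j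
  have sumI: "G x = c None * x ?s
      + (\<Sum>i\<le>n. \<Sum>j\<le>n. \<pi> i j * (x ?s * C i j - x (?a i) - x (?b j)))" for x
  proof -
    have "(\<Sum>k\<in>I. c k * A k x) = c None * x ?s
        + (\<Sum>k\<in>Some ` ({..n} \<times> {..n}). c k * A k x)"
      unfolding I_def by (subst sum.insert) (auto simp: A_def)
    also have "(\<Sum>k\<in>Some ` ({..n} \<times> {..n}). c k * A k x)
        = (\<Sum>(i,j)\<in>{..n} \<times> {..n}. \<pi> i j * (x ?s * C i j - x (?a i) - x (?b j)))"
      by (subst sum.reindex) (auto simp: A_def \<pi>_def intro!: sum.cong)
    also have "\<dots> = (\<Sum>i\<le>n. \<Sum>j\<le>n. \<pi> i j * (x ?s * C i j - x (?a i) - x (?b j)))"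
      by (rule sum.cartesian_product[symmetric])
    finally show ?thesis using c(2) by simp
  qed
  show ?thesis
  proof
    show "0 \<le> \<pi> i j" for i j using c(1) by (auto simp: \<pi>_def I_def)
    show "(\<Sum>j\<le>n. \<pi> i j) = p i" if "i \<le> n" for i
    proof -
      have "G (\<lambda>k. if k = ?a i then -1 else 0) = p i"
        using that by (simp add: G_def if_distrib[of "\<lambda>x. x * _"] cong: if_cong)
      moreover have "(\<Sum>i'\<le>n. \<Sum>j\<le>n. \<pi> i' j * (0 * C i' j - (if i' = i then -1 else 0) - 0))
          = (\<Sum>i'\<le>n. if i' = i then \<Sum>j\<le>n. \<pi> i j else 0)"
        by (intro sum.cong) auto
      ultimately show ?thesis
        using sumI[of "\<lambda>k. if k = ?a i then -1 else 0"] that by simp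
    qed
    show "(\<Sum>i\<le>n. \<pi> i j) = q j" if "j \<le> n" for j
    proof -
      have "G (\<lambda>k. if k = ?b j then -1 else 0) = q j"
        using that by (simp add: G_def if_distrib[of "\<lambda>x. x * _"] cong: if_cong)
      moreover have "(\<Sum>i\<le>n. \<Sum>j'\<le>n. \<pi> i j' * (0 * C i j' - 0 - (if j' = j then -1 else 0)))
          = (\<Sum>i\<le>n. \<Sum>j'\<le>n. if j' = j then \<pi> i j else 0)"
        by (intro sum.cong) auto
      ultimately show ?thesis
        using sumI[of "\<lambda>k. if k = ?b j then -1 else 0"] that by simp
    qed
    have "G (\<lambda>k. if k = ?s then 1 else 0) = V" by (simp add: G_def)
    moreover have "0 \<le> c None" using c(1) by (simp add: I_def)
    ultimately show "(\<Sum>i\<le>n. \<Sum>j\<le>n. C i j * \<pi> i j) \<le> V"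
      using sumI[of "\<lambda>k. if k = ?s then 1 else 0"] by (simp add: mult.commute)
  qed
qed

lemma seq_compact_unit_cube:
  fixes f :: "nat \<Rightarrow> 'i::countable \<Rightarrow> real"
  assumes "\<And>n i. f n i \<in> {0..1}"
  obtains r g where "strict_mono (r :: nat \<Rightarrow> nat)" "\<And>i. (\<lambda>n. f (r n) i) \<longlonglongrightarrow> g i"
proof -
  have "compactin (product_topology (\<lambda>i::'i. euclideanreal) UNIV) (PiE UNIV (\<lambda>i. {0..1}))"
    by (simp add: compactin_PiE)
  then have "compact (PiE UNIV (\<lambda>i::'i. {0..1::real}))"
    by (simp add: euclidean_product_topology)
  then have "seq_compact (PiE UNIV (\<lambda>i::'i. {0..1::real}))"
    by (rule compact_imp_seq_compact)
  moreover have "\<forall>n. f n \<in> PiE UNIV (\<lambda>i. {0..1})"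
    using assms by auto
  ultimately obtain g r where "strict_mono r" "(f \<circ> r) \<longlonglongrightarrow> g"
    unfolding seq_compact_def by meson
  moreover have "(\<lambda>n. f (r n) i) \<longlonglongrightarrow> g i" for i
    using continuous_on_tendsto_compose[OF continuous_on_product_coordinates[of i] \<open>(f \<circ> r) \<longlonglongrightarrow> g\<close>]
    by (simp add: o_def)
  ultimately show ?thesis using that by blast
qed

text \<open>
  The mass distribution in which all points from \<open>n\<close> onwards are merged into the point \<open>n\<close>.
\<close>

definition lump :: "nat \<Rightarrow> (nat \<Rightarrow> real) \<Rightarrow> nat \<Rightarrow> real" where
  "lump n p i = (if i < n then p i else 1 - (\<Sum>k<n. p k))"

text \<open>
  Tightness: what row \<open>i\<close> sends to columns from \<open>M\<close> onwards is bounded by the total mass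
  \<open>1 - (\<Sum>k<M. q k)\<close> of these columns, uniformly in \<open>n\<close>, so no mass escapes in the limit.
\<close>

lemma lumped_marginal_limit:
  fixes f :: "nat \<Rightarrow> nat \<Rightarrow> nat \<Rightarrow> real"
  assumes f0: "\<And>n i j. 0 \<le> f n i j"
    and row: "\<And>n i. i \<le> n \<Longrightarrow> (\<Sum>j\<le>n. f n i j) = lump n p i"
    and col: "\<And>n j. j \<le> n \<Longrightarrow> (\<Sum>i\<le>n. f n i j) = lump n q j"
    and r: "strict_mono r" and lim: "\<And>i j. (\<lambda>n. f (r n) i j) \<longlonglongrightarrow> g i j"
    and q: "q sums 1"
  shows "(\<lambda>j. g i j) sums p i"
proof -
  have r_ge: "n \<le> r n" for n using r by (rule seq_suble)
  have partial_le: "(\<Sum>j<M. f n i j) \<le> p i" if "M \<le> n" "i < n" for M n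
  proof -
    have "(\<Sum>j<M. f n i j) \<le> (\<Sum>j\<le>n. f n i j)"
      using that f0 by (intro sum_mono2) auto
    then show ?thesis using row[of i n] that by (simp add: lump_def)
  qed
  have partial_ge: "p i - (1 - (\<Sum>k<M. q k)) \<le> (\<Sum>j<M. f n i j)" if M: "M < n" "i < n" for M n
  proof -
    have cols: "(\<Sum>j\<in>{M..n}. lump n q j) = 1 - (\<Sum>k<M. q k)"
    proof -
      have "(\<Sum>j\<in>{M..n}. lump n q j) = (\<Sum>j\<in>{M..<n}. lump n q j) + lump n q n"
        using M by (metis add.commute atLeastLessThanSuc_atLeastAtMost less_imp_le_nat sum.atLeastLessThan_Suc)
      also have "(\<Sum>j\<in>{M..<n}. lump n q j) = (\<Sum>j\<in>{M..<n}. q j)"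
        by (intro sum.cong) (auto simp: lump_def)
      also have "(\<Sum>j\<in>{M..<n}. q j) = (\<Sum>k<n. q k) - (\<Sum>k<M. q k)"
        using M by (metis diff_add_cancel add_diff_cancel_left' lessThan_atLeast0 less_imp_le_nat sum.atLeastLessThan_concat zero_le)
      finally show ?thesis by (simp add: lump_def)
    qed
    have "p i = (\<Sum>j\<le>n. f n i j)" using row[of i n] M by (simp add: lump_def)
    also have "\<dots> = (\<Sum>j<M. f n i j) + (\<Sum>j\<in>{M..n}. f n i j)"
      using M by (subst sum.union_disjoint[symmetric]) (auto intro!: sum.cong)
    also have "(\<Sum>j\<in>{M..n}. f n i j) \<le> (\<Sum>j\<in>{M..n}. \<Sum>i\<le>n. f n i j)"
      using M f0 by (intro sum_mono member_le_sum) auto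
    also have "\<dots> = (\<Sum>j\<in>{M..n}. lump n q j)"
      by (intro sum.cong col) auto
    finally show ?thesis unfolding cols by simp
  qed
  have limM: "(\<lambda>n. \<Sum>j<M. f (r n) i j) \<longlonglongrightarrow> (\<Sum>j<M. g i j)" for M
    by (intro tendsto_sum lim)
  have ev: "eventually (\<lambda>n. M < r n \<and> i < r n) sequentially" for M
    using eventually_gt_at_top[of "max M i"]
    by eventually_elim (use r_ge in \<open>auto intro: less_le_trans\<close>)
  have upper: "(\<Sum>j<M. g i j) \<le> p i" for M
    using ev[of M] by (intro tendsto_upperbound[OF limM]) (auto elim!: eventually_mono intro!: partial_le)
  have lower: "p i - (1 - (\<Sum>k<M. q k)) \<le> (\<Sum>j<M. g i j)" for M
    using ev[of M] by (intro tendsto_lowerbound[OF limM]) (auto elim!: eventually_mono intro!: partial_ge)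
  have "(\<lambda>M. p i - (1 - (\<Sum>k<M. q k))) \<longlonglongrightarrow> p i - (1 - 1)"
    using q unfolding sums_def by (intro tendsto_intros)
  then have "(\<lambda>M. p i - (1 - (\<Sum>k<M. q k))) \<longlonglongrightarrow> p i"
    by simp
  then have "(\<lambda>M. \<Sum>j<M. g i j) \<longlonglongrightarrow> p i"
    using lower upper by (rule_tac tendsto_sandwich[OF always_eventually always_eventually _ tendsto_const]) auto
  then show ?thesis
    unfolding sums_def .
qed

text \<open>
  The tail is merged into one point to and from which transport is free; this
  only lowers the cost, so the merged finite problems have plans of cost at most \<open>V\<close>. Entrywise
  limits along a subsequence keep the marginals by tightness and the cost bound because every
  finite part of the cost is eventually counted in full.
\<close>

lemma countable_transport_duality:
  fixes C :: "nat \<Rightarrow> nat \<Rightarrow> real" and p q :: "nat \<Rightarrow> real"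
  assumes C: "\<And>i j. 0 \<le> C i j"
    and p: "\<And>i. 0 \<le> p i" "p sums 1" and q: "\<And>j. 0 \<le> q j" "q sums 1"
    and dual: "\<And>n \<alpha> \<beta>. (\<And>i j. i \<le> n \<Longrightarrow> j \<le> n \<Longrightarrow>
                   \<alpha> i + \<beta> j \<le> (if i < n \<and> j < n then C i j else 0)) \<Longrightarrow>
                 (\<Sum>i\<le>n. \<alpha> i * lump n p i) + (\<Sum>j\<le>n. \<beta> j * lump n q j) \<le> V"
  obtains \<pi> where "\<And>i j. 0 \<le> \<pi> i j"
    and "\<And>i. (\<lambda>j. \<pi> i j) sums p i" and "\<And>j. (\<lambda>i. \<pi> i j) sums q j"
    and "\<And>n. (\<Sum>i<n. \<Sum>j<n. C i j * \<pi> i j) \<le> V"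
proof -
  let ?C = "\<lambda>n i j. if i < n \<and> j < n then C i j else 0"
  define optimal where "optimal n f \<longleftrightarrow> (\<forall>i j. 0 \<le> f i j)
      \<and> (\<forall>i\<le>n. (\<Sum>j\<le>n. f i j) = lump n p i) \<and> (\<forall>j\<le>n. (\<Sum>i\<le>n. f i j) = lump n q j)
      \<and> (\<Sum>i\<le>n. \<Sum>j\<le>n. ?C n i j * f i j) \<le> V" for n and f :: "nat \<Rightarrow> nat \<Rightarrow> real"
  have "\<exists>f. optimal n f" for n
    unfolding optimal_def
    by (rule finite_transport_duality[of "?C n" n "lump n p" "lump n q" V]) (use C dual in auto)
  then obtain f' where "\<And>n. optimal n (f' n)"
    by metis
  then have f': "\<And>n i j. 0 \<le> f' n i j"
      "\<And>n i. i \<le> n \<Longrightarrow> (\<Sum>j\<le>n. f' n i j) = lump n p i"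
      "\<And>n j. j \<le> n \<Longrightarrow> (\<Sum>i\<le>n. f' n i j) = lump n q j"
      "\<And>n. (\<Sum>i\<le>n. \<Sum>j\<le>n. ?C n i j * f' n i j) \<le> V"
    unfolding optimal_def by auto
  \<comment> \<open>plans are extended by zero so that all entries lie in the unit interval\<close>
  define f where "f n i j = (if i \<le> n \<and> j \<le> n then f' n i j else 0)" for n i j
  have f: "\<And>n i j. 0 \<le> f n i j"
    using f'(1) by (simp add: f_def)
  have row: "(\<Sum>j\<le>n. f n i j) = lump n p i" if "i \<le> n" for n i
    using f'(2)[OF that] that by (simp add: f_def cong: sum.cong_simp)
  have col: "(\<Sum>i\<le>n. f n i j) = lump n q j" if "j \<le> n" for n j
    using f'(3)[OF that] that by (simp add: f_def cong: sum.cong_simp)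
  have cost: "(\<Sum>i\<le>n. \<Sum>j\<le>n. ?C n i j * f n i j) \<le> V" for n
  proof -
    have "(\<Sum>i\<le>n. \<Sum>j\<le>n. ?C n i j * f n i j) = (\<Sum>i\<le>n. \<Sum>j\<le>n. ?C n i j * f' n i j)"
      by (intro sum.cong) (auto simp: f_def)
    then show ?thesis using f'(4)[of n] by simp
  qed
  have "f n i j \<le> 1" for n i j
  proof (cases "i \<le> n \<and> j \<le> n")
    case True
    have "f n i j \<le> (\<Sum>j\<le>n. f n i j)" using True f by (intro member_le_sum) auto
    also have "\<dots> = lump n p i" using True row by simp
    also have "\<dots> \<le> 1"
    proof -
      have "p i \<le> 1" using sum_le_suminf[of p "{i}"] p by (simp add: sums_iff)
      then show ?thesis using p by (auto simp: lump_def intro: sum_nonneg)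
    qed
    finally show ?thesis .
  qed (auto simp: f_def)
  then obtain r g' where r: "strict_mono (r :: nat \<Rightarrow> nat)"
      and lim': "\<And>ij. (\<lambda>n. case ij of (i, j) \<Rightarrow> f (r n) i j) \<longlonglongrightarrow> g' ij"
    by (rule_tac seq_compact_unit_cube[of "\<lambda>n (i, j). f n i j"]) (use f in auto)
  define g where "g i j = g' (i, j)" for i j
  have lim: "(\<lambda>n. f (r n) i j) \<longlonglongrightarrow> g i j" for i j
    using lim'[of "(i, j)"] by (simp add: g_def)
  show ?thesis
  proof
    show "0 \<le> g i j" for i j
      using f by (intro tendsto_lowerbound[OF lim]) auto
    show "(\<lambda>j. g i j) sums p i" for i
      by (rule lumped_marginal_limit[of f p q r g i, OF f row col r lim q(2)])
    show "(\<lambda>i. g i j) sums q j" for j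
      by (rule lumped_marginal_limit[of "\<lambda>n i j. f n j i" q p r "\<lambda>i j. g j i" j, OF f col row r lim p(2)])
    fix M
    have bound: "(\<Sum>i<M. \<Sum>j<M. C i j * f n i j) \<le> V" if "M \<le> n" for n
    proof -
      have "(\<Sum>i<M. \<Sum>j<M. C i j * f n i j) = (\<Sum>i<M. \<Sum>j<M. ?C n i j * f n i j)"
        using that by (intro sum.cong) auto
      also have "\<dots> \<le> (\<Sum>i\<le>n. \<Sum>j<M. ?C n i j * f n i j)"
        using that C f by (intro sum_mono2 sum_nonneg) auto
      also have "\<dots> \<le> (\<Sum>i\<le>n. \<Sum>j\<le>n. ?C n i j * f n i j)"
        using that C f by (intro sum_mono sum_mono2) auto
      finally show ?thesis using cost[of n] by linarith
    qed
    have "eventually (\<lambda>n. (\<Sum>i<M. \<Sum>j<M. C i j * f (r n) i j) \<le> V) sequentially"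
      using eventually_ge_at_top[of M]
      by eventually_elim (intro bound order_trans[OF _ seq_suble[OF r]])
    moreover have "(\<lambda>n. \<Sum>i<M. \<Sum>j<M. C i j * f (r n) i j) \<longlonglongrightarrow> (\<Sum>i<M. \<Sum>j<M. C i j * g i j)"
      by (intro tendsto_intros lim)
    ultimately show "(\<Sum>i<M. \<Sum>j<M. C i j * g i j) \<le> V"
      by (intro tendsto_upperbound) auto
  qed
qed

section \<open>Exhaustion of finite measures\<close>

text \<open>
  A countable union of members of \<open>\<G>\<close> of maximal measure exists since the supremum is reached
  along a sequence; any member disjoint from it can be added without gaining measure.
\<close>

lemma exhaustion:
  assumes "finite_measure M" and G: "\<G> \<subseteq> sets M" "{} \<in> \<G>"
  obtains A :: "nat \<Rightarrow> 'a set" where "range A \<subseteq> \<G>"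
    and "\<And>B. B \<in> \<G> \<Longrightarrow> B \<inter> (\<Union>n. A n) = {} \<Longrightarrow> B \<in> null_sets M"
proof -
  interpret finite_measure M by fact
  define S where "S = (\<lambda>A :: nat \<Rightarrow> 'a set. emeasure M (\<Union>n. A n)) ` {A. range A \<subseteq> \<G>}"
  have "range (\<lambda>_::nat. {}) \<subseteq> \<G>" using G(2) by auto
  then have "S \<noteq> {}" unfolding S_def by blast
  then obtain f :: "nat \<Rightarrow> ennreal" where f: "range f \<subseteq> S" "Sup S = (SUP i. f i)"
    using ennreal_Sup_countable_SUP by metis
  have "\<forall>i. \<exists>A :: nat \<Rightarrow> 'a set. range A \<subseteq> \<G> \<and> f i = emeasure M (\<Union>n. A n)"
  proof
    fix i
    have "f i \<in> S" using f(1) by blast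
    then obtain A :: "nat \<Rightarrow> 'a set" where "f i = emeasure M (\<Union>n. A n)" "range A \<subseteq> \<G>"
      unfolding S_def by blast
    then show "\<exists>A :: nat \<Rightarrow> 'a set. range A \<subseteq> \<G> \<and> f i = emeasure M (\<Union>n. A n)" by blast
  qed
  then obtain A' :: "nat \<Rightarrow> nat \<Rightarrow> 'a set" where "\<forall>i. range (A' i) \<subseteq> \<G> \<and> f i = emeasure M (\<Union>n. A' i n)"
    by (rule choice[THEN exE])
  then have A': "\<And>i. range (A' i) \<subseteq> \<G>" "\<And>i. f i = emeasure M (\<Union>n. A' i n)"
    by auto
  define A where "A k = (case prod_decode k of (i, n) \<Rightarrow> A' i n)" for k
  have "A' i n = A (prod_encode (i, n))" for i n by (simp add: A_def)
  then have sub: "(\<Union>n. A' i n) \<subseteq> (\<Union>k. A k)" for i by blast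
  have A: "range A \<subseteq> \<G>" using A'(1) by (force simp: A_def split: prod.split)
  have meas: "A k \<in> sets M" for k using A G(1) by blast
  have "Sup S \<le> emeasure M (\<Union>k. A k)"
    unfolding f(2)
  proof (rule SUP_least)
    show "f i \<le> emeasure M (\<Union>k. A k)" for i
      unfolding A'(2) using sub meas by (intro emeasure_mono) auto
  qed
  show ?thesis
  proof (rule that[OF A])
    fix B assume B: "B \<in> \<G>" "B \<inter> (\<Union>n. A n) = {}"
    define A2 where "A2 n = (case n of 0 \<Rightarrow> B | Suc m \<Rightarrow> A m)" for n
    have "range A2 \<subseteq> \<G>" using A B by (force simp: A2_def split: nat.split)
    moreover have "(\<Union>n. A2 n) = B \<union> (\<Union>n. A n)"
      by (auto simp: A2_def split: nat.splits)
    ultimately have "emeasure M (B \<union> (\<Union>n. A n)) \<in> S" unfolding S_def by (intro image_eqI[of _ _ A2]) simp_all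
    then have "emeasure M (B \<union> (\<Union>n. A n)) \<le> emeasure M (\<Union>k. A k)"
      using \<open>Sup S \<le> _\<close> by (meson Sup_upper order_trans)
    moreover have "emeasure M (B \<union> (\<Union>n. A n)) = emeasure M B + emeasure M (\<Union>n. A n)"
      using B G(1) meas by (intro plus_emeasure[symmetric]) auto
    ultimately have "measure M B + measure M (\<Union>n. A n) \<le> measure M (\<Union>n. A n)"
      by (simp add: emeasure_eq_measure flip: ennreal_plus)
    then have "emeasure M B = 0"
      by (simp add: emeasure_eq_measure ennreal_eq_0_iff)
    then show "B \<in> null_sets M" using B(1) G(1) by auto
  qed
qed

text \<open>
  Exhaust by sets of measure at most \<open>\<eta>\<close>. In a remainder of positive measure all positive subsets
  would exceed \<open>\<eta>\<close>; splitting one whose measure is within \<open>\<eta>\<close> of the infimum leaves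
  a part below \<open>\<eta>\<close>.
\<close>

lemma atomless_small_pieces:
  assumes "finite_measure M"
    and split: "\<And>J. J \<in> sets M \<Longrightarrow> J \<notin> null_sets M \<Longrightarrow>
                  \<exists>H\<in>sets M. H \<subseteq> J \<and> H \<notin> null_sets M \<and> J - H \<notin> null_sets M"
    and "0 < \<eta>"
  obtains J :: "nat \<Rightarrow> 'a set" where "range J \<subseteq> sets M" "disjoint_family J"
    and "\<And>n. measure M (J n) \<le> \<eta>" and "space M - (\<Union>n. J n) \<in> null_sets M"
proof -
  interpret finite_measure M by fact
  define \<G> where "\<G> = {J \<in> sets M. measure M J \<le> \<eta>}"
  have "\<G> \<subseteq> sets M" "{} \<in> \<G>" using \<open>0 < \<eta>\<close> by (auto simp: \<G>_def)
  then obtain A :: "nat \<Rightarrow> 'a set" where A: "range A \<subseteq> \<G>"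
    and rest: "\<And>B. B \<in> \<G> \<Longrightarrow> B \<inter> (\<Union>n. A n) = {} \<Longrightarrow> B \<in> null_sets M"
    using exhaustion[OF assms(1)] by blast
  have Am: "A n \<in> sets M" for n using A by (auto simp: \<G>_def)
  define F where "F = space M - (\<Union>n. A n)"
  have F: "F \<in> sets M" using Am by (auto simp: F_def)
  have "F \<in> null_sets M"
  proof (rule ccontr)
    assume "F \<notin> null_sets M"
    define T where "T = {H \<in> sets M. H \<subseteq> F \<and> H \<notin> null_sets M}"
    have big: "\<eta> < measure M H" if "H \<in> T" for H
      using rest[of H] that by (force simp: T_def F_def \<G>_def)
    have ne: "F \<in> T" using F \<open>F \<notin> _\<close> by (simp add: T_def)
    have bdd: "bdd_below (measure M ` T)" by (intro bdd_belowI2[of _ 0]) auto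
    have "Inf (measure M ` T) < Inf (measure M ` T) + \<eta>" using \<open>0 < \<eta>\<close> by simp
    then obtain H where H: "H \<in> T" "measure M H < Inf (measure M ` T) + \<eta>"
      using cInf_lessD[of "measure M ` T"] ne by blast
    then obtain H' where H': "H' \<in> sets M" "H' \<subseteq> H" "H' \<notin> null_sets M" "H - H' \<notin> null_sets M"
      using split[of H] by (auto simp: T_def)
    have T': "H' \<in> T" "H - H' \<in> T" using H H' by (auto simp: T_def)
    have "Inf (measure M ` T) \<le> measure M H'" using T' bdd by (intro cInf_lower) auto
    moreover have "\<eta> < measure M (H - H')" using big T' by simp
    moreover have "measure M (H - H') = measure M H - measure M H'"
      using H H' by (intro finite_measure_Diff) (auto simp: T_def)
    ultimately show False using H(2) by linarith
  qed
  show ?thesis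
  proof
    show "range (disjointed A) \<subseteq> sets M" using Am by (intro sets.range_disjointed_sets) auto
    then have dm: "disjointed A n \<in> sets M" for n by blast
    show "disjoint_family (disjointed A)" by (rule disjoint_family_disjointed)
    show "measure M (disjointed A n) \<le> \<eta>" for n
    proof -
      have "measure M (disjointed A n) \<le> measure M (A n)"
        using Am disjointed_subset[of A n] by (intro finite_measure_mono) auto
      moreover have "A n \<in> \<G>" using A by blast
      ultimately show ?thesis by (simp add: \<G>_def)
    qed
    show "space M - (\<Union>n. disjointed A n) \<in> null_sets M"
      using \<open>F \<in> null_sets M\<close> by (simp add: UN_disjointed_eq F_def)
  qed
qed

section \<open>Blocks and the product \<sigma>-algebra\<close>

text \<open>
  The pieces of the set are the fibres of the labelling \<open>l\<close>. A set of diameter at most \<open>\<epsilon>\<close> is a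
  block through a constant labelling. The set of labels carries a two-valued measure defined
  on all its subsets, possibly a nonprincipal one if measurable cardinals exist.
\<close>

definition block :: "'a::metric_space measure \<Rightarrow> real \<Rightarrow> 'a set \<Rightarrow> bool" where
  "block \<nu> \<epsilon> A \<longleftrightarrow> A \<in> sets \<nu> \<and>
     (\<exists>l::'a \<Rightarrow> 'a. (\<forall>x\<in>A. \<forall>y\<in>A. l x = l y \<longrightarrow> dist x y \<le> \<epsilon>) \<and>
        (\<forall>J. A \<inter> l -` J \<in> null_sets \<nu> \<or> A - l -` J \<in> null_sets \<nu>))"

lemma block_subset:
  assumes "block \<nu> \<epsilon> A" "B \<subseteq> A" "B \<in> sets \<nu>"
  shows "block \<nu> \<epsilon> B"
proof -
  obtain l :: "'a \<Rightarrow> 'a" where l: "\<forall>x\<in>A. \<forall>y\<in>A. l x = l y \<longrightarrow> dist x y \<le> \<epsilon>"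
    "\<And>J. A \<inter> l -` J \<in> null_sets \<nu> \<or> A - l -` J \<in> null_sets \<nu>"
    using assms(1) unfolding block_def by blast
  have "B \<inter> l -` J \<in> null_sets \<nu> \<or> B - l -` J \<in> null_sets \<nu>" for J
  proof -
    have "B \<inter> l -` J = B \<inter> (A \<inter> l -` J)" "B - l -` J = B \<inter> (A - l -` J)"
      using assms(2) by auto
    then show ?thesis using l(2)[of J] assms(3) by (metis null_set_Int1)
  qed
  then show ?thesis using l(1) assms(2,3) unfolding block_def by blast
qed

text \<open>
  Membership of \<open>(x, y)\<close> in \<open>S\<close> depends only on the traces of \<open>x\<close> on the sequence \<open>C\<close> and
  of \<open>y\<close> on the sequence \<open>D\<close>.
\<close>

definition determined_by :: "(nat \<Rightarrow> 'a set) \<Rightarrow> (nat \<Rightarrow> 'b set) \<Rightarrow> ('a \<times> 'b) set \<Rightarrow> bool" where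
  "determined_by C D S \<longleftrightarrow> (\<forall>x x' y y'. (\<forall>n. x \<in> C n \<longleftrightarrow> x' \<in> C n) \<longrightarrow> (\<forall>n. y \<in> D n \<longleftrightarrow> y' \<in> D n) \<longrightarrow>
     ((x, y) \<in> S \<longleftrightarrow> (x', y') \<in> S))"

text \<open>
  Every set of a generated \<open>\<sigma>\<close>-algebra lies in the one generated by countably many of the
  generators.
\<close>

lemma pair_sets_countably_determined:
  fixes S :: "('a::topological_space \<times> 'b::topological_space) set"
  assumes "S \<in> sets (borel \<Otimes>\<^sub>M borel)"
  obtains C D where "determined_by C D S"
proof -
  have "S \<in> sigma_sets UNIV {a \<times> b |(a::'a set) (b::'b set). a \<in> sets borel \<and> b \<in> sets borel}"
    using assms by (simp add: sets_pair_measure)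
  then have "\<exists>C D. determined_by C D S"
  proof (induction rule: sigma_sets.induct)
    case (Basic S)
    then obtain a b where "S = a \<times> b" by auto
    then have "determined_by (\<lambda>_. a) (\<lambda>_. b) S" by (simp add: determined_by_def)
    then show ?case by blast
  next
    case Empty
    then show ?case by (auto simp: determined_by_def)
  next
    case (Compl S)
    then obtain C D where "determined_by C D S" by blast
    then have "determined_by C D (UNIV - S)" by (simp add: determined_by_def)
    then show ?case by blast
  next
    case (Union S)
    then have "\<forall>i. \<exists>CD. determined_by (fst CD) (snd CD) (S i)" by simp
    then obtain CD where "\<forall>i. determined_by (fst (CD i)) (snd (CD i)) (S i)"
      by (rule choice[THEN exE])
    then have CD: "\<And>i. determined_by (fst (CD i)) (snd (CD i)) (S i)" by blast
    define C where "C k = (case prod_decode k of (i, n) \<Rightarrow> fst (CD i) n)" for k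
    define D where "D k = (case prod_decode k of (i, n) \<Rightarrow> snd (CD i) n)" for k
    have enc: "fst (CD i) n = C (prod_encode (i, n))" "snd (CD i) n = D (prod_encode (i, n))" for i n
      by (simp_all add: C_def D_def)
    have "determined_by C D (\<Union>i. S i)"
      unfolding determined_by_def
    proof (intro allI impI)
      fix x x' y y'
      assume "\<forall>n. x \<in> C n \<longleftrightarrow> x' \<in> C n" "\<forall>n. y \<in> D n \<longleftrightarrow> y' \<in> D n"
      then have "(x, y) \<in> S i \<longleftrightarrow> (x', y') \<in> S i" for i
        using CD[of i] unfolding determined_by_def enc by blast
      then show "(x, y) \<in> (\<Union>i. S i) \<longleftrightarrow> (x', y') \<in> (\<Union>i. S i)" by simp
    qed
    then show ?case by blast
  qed
  then show ?thesis using that by blast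
qed

text \<open>
  A two-valued measure is constant on a countable sequence of yes/no questions, so if a point is
  selected in each piece of a full family of pieces, almost all selected points have the same
  trace on \<open>C\<close>. Were the points whose trace occurs only in a null family of pieces not
  negligible, one could select such a point in almost every piece; the common trace of the selected
  points would then occur in a full family of pieces.
\<close>

lemma almost_every_trace_is_full:
  fixes l :: "'a \<Rightarrow> 'b" and C :: "nat \<Rightarrow> 'a set"
  assumes two: "\<And>J. A \<inter> l -` J \<in> null_sets \<nu> \<or> A - l -` J \<in> null_sets \<nu>"
    and A: "A \<in> sets \<nu>"
  obtains N where "N \<in> null_sets \<nu>"
    and "\<And>x. x \<in> A - N \<Longrightarrow>
           A - l -` l ` {x' \<in> A. \<forall>n. x \<in> C n \<longleftrightarrow> x' \<in> C n} \<in> null_sets \<nu>"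
proof -
  define I where "I x = l ` {x' \<in> A. \<forall>n. x \<in> C n \<longleftrightarrow> x' \<in> C n}" for x
  define E where "E = {x \<in> A. A \<inter> l -` I x \<in> null_sets \<nu>}"
  define L where "L = l ` E"
  have "A \<inter> l -` L \<in> null_sets \<nu>"
  proof (rule ccontr)
    assume not_null: "A \<inter> l -` L \<notin> null_sets \<nu>"
    define s where "s = inv_into E l"
    have s: "\<And>i. i \<in> L \<Longrightarrow> s i \<in> E" "\<And>i. i \<in> L \<Longrightarrow> l (s i) = i"
      unfolding s_def L_def by (auto intro: inv_into_into f_inv_into_f)
    \<comment> \<open>\<open>b\<close> is the trace that almost all selected points share; \<open>Q n\<close> collects the labels that agree with it at \<open>n\<close>\<close>
    define P where "P n = {i \<in> L. s i \<in> C n}" for n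
    define b where "b n \<longleftrightarrow> A \<inter> l -` P n \<notin> null_sets \<nu>" for n
    define Q where "Q n = {i \<in> L. (s i \<in> C n) = b n}" for n
    have Q: "A - l -` Q n \<in> null_sets \<nu>" for n
    proof -
      have L: "A - l -` L \<in> null_sets \<nu>" using two[of L] not_null by blast
      show ?thesis
      proof (cases "b n")
        case True
        then have "Q n = P n" by (auto simp: Q_def P_def)
        then show ?thesis using True two[of "P n"] by (simp add: b_def)
      next
        case False
        then have "A - l -` Q n = (A - l -` L) \<union> (A \<inter> l -` P n)" by (auto simp: Q_def P_def)
        then show ?thesis using False L by (auto simp: b_def)
      qed
    qed
    have "A - l -` (L \<inter> (\<Inter>n. Q n)) \<in> null_sets \<nu>"
    proof -
      have "A - l -` (L \<inter> (\<Inter>n. Q n)) = (A - l -` L) \<union> (\<Union>n. A - l -` Q n)" by auto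
      moreover have "A - l -` L \<in> null_sets \<nu>" using two[of L] not_null by blast
      moreover have "(\<Union>n. A - l -` Q n) \<in> null_sets \<nu>" using Q by (intro null_sets_UN) auto
      ultimately show ?thesis by (metis null_sets.Un)
    qed
    then have nn: "A \<inter> l -` (L \<inter> (\<Inter>n. Q n)) \<notin> null_sets \<nu>"
    proof -
      have "A = (A \<inter> l -` (L \<inter> (\<Inter>n. Q n))) \<union> (A - l -` (L \<inter> (\<Inter>n. Q n)))" by blast
      moreover have "A \<notin> null_sets \<nu>"
      proof
        assume "A \<in> null_sets \<nu>"
        moreover have "A - l -` L \<in> null_sets \<nu>" using two[of L] not_null by blast
        ultimately have "A - (A - l -` L) \<in> null_sets \<nu>"
          by (intro null_set_Diff) auto
        moreover have "A - (A - l -` L) = A \<inter> l -` L" by blast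
        ultimately show False using not_null by simp
      qed
      ultimately show ?thesis
        using \<open>A - l -` (L \<inter> (\<Inter>n. Q n)) \<in> null_sets \<nu>\<close> by (metis null_sets.Un)
    qed
    then have "A \<inter> l -` (L \<inter> (\<Inter>n. Q n)) \<noteq> {}" by force
    then obtain x where x: "x \<in> A" "l x \<in> L" "\<And>n. l x \<in> Q n" by blast
    have "L \<inter> (\<Inter>n. Q n) \<subseteq> I (s (l x))"
    proof
      fix i assume i: "i \<in> L \<inter> (\<Inter>n. Q n)"
      then have "s i \<in> A" "l (s i) = i" using s by (auto simp: E_def)
      moreover have "s (l x) \<in> C n \<longleftrightarrow> s i \<in> C n" for n
        using x(3)[of n] i by (auto simp: Q_def)
      ultimately show "i \<in> I (s (l x))" unfolding I_def by force
    qed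
    then have "A \<inter> l -` (L \<inter> (\<Inter>n. Q n)) = (A \<inter> l -` I (s (l x))) - (A - l -` (L \<inter> (\<Inter>n. Q n)))"
      by auto
    moreover have "A \<inter> l -` I (s (l x)) \<in> null_sets \<nu>"
      using s(1)[OF x(2)] by (simp add: E_def)
    ultimately have "A \<inter> l -` (L \<inter> (\<Inter>n. Q n)) \<in> null_sets \<nu>"
      using \<open>A - l -` (L \<inter> (\<Inter>n. Q n)) \<in> null_sets \<nu>\<close> by (simp add: null_set_Diff null_setsD2)
    then show False using nn by blast
  qed
  then show ?thesis
  proof (rule that)
    fix x assume "x \<in> A - (A \<inter> l -` L)"
    then have "x \<in> A" "x \<notin> E" by (auto simp: L_def)
    then show "A - l -` l ` {x' \<in> A. \<forall>n. x \<in> C n \<longleftrightarrow> x' \<in> C n} \<in> null_sets \<nu>"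
      using two[of "I x"] by (auto simp: E_def I_def)
  qed
qed

text \<open>
  Choose a point \<open>(x, y)\<close> of \<open>S\<close> whose traces occur in almost every piece of \<open>A\<close> and of
  \<open>B\<close>. In almost every pair of pieces there are then points with the same traces; they belong to
  \<open>S\<close>, hence are at distance at least \<open>c\<close>, and replacing them by other points of their pieces
  costs at most \<open>\<epsilon>\<close> each.
\<close>

lemma block_rectangle:
  fixes \<nu> :: "'a::metric_space measure"
  assumes \<nu>: "sets \<nu> = sets borel"
    and A: "block \<nu> \<epsilon> A" and B: "block \<nu> \<epsilon> B"
    and S: "S \<in> sets (borel \<Otimes>\<^sub>M borel)" "S \<subseteq> A \<times> B"
    and far: "\<And>x y. (x, y) \<in> S \<Longrightarrow> c \<le> dist x y"
    and nonnull: "\<And>N. N \<in> null_sets \<nu> \<Longrightarrow> \<exists>(x, y)\<in>S. x \<notin> N \<and> y \<notin> N"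
  obtains N where "N \<in> null_sets \<nu>"
    and "\<And>x y. x \<in> A - N \<Longrightarrow> y \<in> B - N \<Longrightarrow> c - 2 * \<epsilon> \<le> dist x y"
proof -
  obtain l :: "'a \<Rightarrow> 'a" where l: "\<And>x y. x \<in> A \<Longrightarrow> y \<in> A \<Longrightarrow> l x = l y \<Longrightarrow> dist x y \<le> \<epsilon>"
    and l2: "\<And>J. A \<inter> l -` J \<in> null_sets \<nu> \<or> A - l -` J \<in> null_sets \<nu>"
    using A unfolding block_def by blast
  obtain k :: "'a \<Rightarrow> 'a" where k: "\<And>x y. x \<in> B \<Longrightarrow> y \<in> B \<Longrightarrow> k x = k y \<Longrightarrow> dist x y \<le> \<epsilon>"
    and k2: "\<And>J. B \<inter> k -` J \<in> null_sets \<nu> \<or> B - k -` J \<in> null_sets \<nu>"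
    using B unfolding block_def by blast
  obtain C D where "determined_by C D S"
    by (rule pair_sets_countably_determined[OF S(1)])
  then have CD: "(x, y) \<in> S \<longleftrightarrow> (x', y') \<in> S"
    if "\<forall>n. x \<in> C n \<longleftrightarrow> x' \<in> C n" "\<forall>n. y \<in> D n \<longleftrightarrow> y' \<in> D n" for x x' y y'
    using that unfolding determined_by_def by blast
  obtain N1 where N1: "N1 \<in> null_sets \<nu>"
    "\<And>x. x \<in> A - N1 \<Longrightarrow> A - l -` l ` {x' \<in> A. \<forall>n. x \<in> C n \<longleftrightarrow> x' \<in> C n} \<in> null_sets \<nu>"
    using almost_every_trace_is_full[OF l2, of C] A unfolding block_def by blast
  obtain N2 where N2: "N2 \<in> null_sets \<nu>"
    "\<And>x. x \<in> B - N2 \<Longrightarrow> B - k -` k ` {x' \<in> B. \<forall>n. x \<in> D n \<longleftrightarrow> x' \<in> D n} \<in> null_sets \<nu>"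
    using almost_every_trace_is_full[OF k2, of D] B unfolding block_def by blast
  obtain x y where xy: "(x, y) \<in> S" "x \<notin> N1 \<union> N2" "y \<notin> N1 \<union> N2"
    using nonnull[of "N1 \<union> N2"] N1(1) N2(1) by auto
  define M1 where "M1 = A - l -` l ` {x' \<in> A. \<forall>n. x \<in> C n \<longleftrightarrow> x' \<in> C n}"
  define M2 where "M2 = B - k -` k ` {x' \<in> B. \<forall>n. y \<in> D n \<longleftrightarrow> x' \<in> D n}"
  have "M1 \<union> M2 \<in> null_sets \<nu>"
    using N1(2)[of x] N2(2)[of y] xy S(2) unfolding M1_def M2_def by auto
  then show ?thesis
  proof (rule that)
    fix x1 y1 assume "x1 \<in> A - (M1 \<union> M2)" "y1 \<in> B - (M1 \<union> M2)"
    then obtain x' y' where x': "x1 \<in> A" "x' \<in> A" "l x1 = l x'" "\<forall>n. x \<in> C n \<longleftrightarrow> x' \<in> C n"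
      and y': "y1 \<in> B" "y' \<in> B" "k y1 = k y'" "\<forall>n. y \<in> D n \<longleftrightarrow> y' \<in> D n"
      unfolding M1_def M2_def by auto
    have "(x', y') \<in> S" using CD[OF x'(4) y'(4)] xy(1) by simp
    then have "c \<le> dist x' y'" by (rule far)
    also have "\<dots> \<le> dist x' x1 + dist x1 y1 + dist y1 y'"
      by (metis add.assoc add_left_mono dist_triangle order_trans)
    also have "\<dots> \<le> \<epsilon> + dist x1 y1 + \<epsilon>"
      using l[of x' x1] k[of y1 y'] x' y' by (intro add_mono) auto
    finally show "c - 2 * \<epsilon> \<le> dist x1 y1" by simp
  qed
qed

section \<open>Prekopa-Leindler measures are exhausted by blocks\<close>

lemma PL_D:
  fixes u v w :: "'a::metric_space \<Rightarrow> real"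
  assumes "PL K \<nu>" "0 \<le> t" "t \<le> 1" "integrable \<nu> u" "integrable \<nu> v" "integrable \<nu> w"
    and "\<And>x. 0 < u x" "\<And>x. 0 < v x" "\<And>x. 0 < w x"
    and "\<And>x y z. z \<in> Z t x y \<Longrightarrow>
      u x powr (1 - t) * v y powr t * exp (- K * (t * (1 - t) / 2) * (dist x y)\<^sup>2) \<le> w z"
  shows "(LINT x|\<nu>. u x) powr (1 - t) * (LINT x|\<nu>. v x) powr t \<le> (LINT x|\<nu>. w x)"
proof -
  have "t \<in> {0..1}" using assms by simp
  show ?thesis
    by (rule \<open>PL K \<nu>\<close>[unfolded PL_def, THEN bspec, OF \<open>t \<in> {0..1}\<close>,
          THEN spec[of _ u], THEN spec[of _ v], THEN spec[of _ w], THEN mp])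
      (intro conjI allI ballI assms; assumption)
qed

text \<open>
  The inequality for the indicators of \<open>A\<close>, \<open>B\<close> and \<open>W\<close>, approximated by strictly positive
  functions. For \<open>K \<ge> 0\<close> the distance term only helps.
\<close>

lemma PL_interpolation_sets:
  fixes \<nu> :: "'a::metric_space measure"
  assumes \<nu>: "borel_prob \<nu>" and "PL K \<nu>" "0 \<le> K"
    and sets: "A \<in> sets borel" "B \<in> sets borel" "W \<in> sets borel"
    and t: "0 < t" "t < 1"
    and ZW: "\<And>x y. x \<in> A \<Longrightarrow> y \<in> B \<Longrightarrow> Z t x y \<subseteq> W"
  shows "measure \<nu> A powr (1 - t) * measure \<nu> B powr t \<le> measure \<nu> W"
proof (rule field_le_epsilon)
  interpret prob_space \<nu> using \<nu> by (simp add: borel_prob_def)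
  have [simp]: "sets \<nu> = sets borel" and [simp]: "space \<nu> = UNIV"
    using \<nu> sets_eq_imp_space_eq[of \<nu> borel] by (auto simp: borel_prob_def)
  fix \<eta> :: real assume "0 < \<eta>"
  \<comment> \<open>off the sets, \<open>u\<close> and \<open>v\<close> take the value \<open>e\<close>, chosen so that both \<open>e\<^bsup>t\<^esup>\<close> and \<open>e\<^bsup>1-t\<^esup>\<close> are at most the value \<open>h\<close> of \<open>w\<close>\<close>
  define h where "h = min \<eta> (1/2)"
  define s where "s = min t (1 - t)"
  define e where "e = h powr (1 / s)"
  have h: "0 < h" "h \<le> 1" "h \<le> \<eta>" using \<open>0 < \<eta>\<close> by (auto simp: h_def)
  have s: "0 < s" "s \<le> t" "s \<le> 1 - t" using t by (auto simp: s_def)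
  have e: "0 < e" "e \<le> 1" using h s by (auto simp: e_def intro: powr_le1)
  have e_powr: "e powr a \<le> h" if "s \<le> a" for a
  proof -
    have "e powr a \<le> e powr s" using e that by (intro powr_mono') auto
    also have "\<dots> = h" using h s by (simp add: e_def powr_powr)
    finally show ?thesis .
  qed
  define u where "u x = (if x \<in> A then 1 else e)" for x
  define v where "v x = (if x \<in> B then 1 else e)" for x
  define w where "w x = (if x \<in> W then 1 else h)" for x
  have int_step: "integrable \<nu> (\<lambda>x. if x \<in> C then 1 else c)" if "C \<in> sets borel" for C and c :: real
  proof -
    have "(\<lambda>x. if x \<in> C then 1 else c) = (\<lambda>x. c + (1 - c) * indicator C x)"
      by (auto simp: indicator_def)
    then show ?thesis using that by (simp add: emeasure_eq_measure)
  qed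
  have ge_step: "measure \<nu> C \<le> (LINT x|\<nu>. (if x \<in> C then 1 else c))"
    if "C \<in> sets borel" "0 \<le> c" for C and c :: real
  proof -
    have "measure \<nu> C = (LINT x|\<nu>. indicator C x)"
      using that by simp
    also have "\<dots> \<le> (LINT x|\<nu>. (if x \<in> C then 1 else c))"
      using that by (intro integral_mono int_step) (auto simp: emeasure_eq_measure split: split_indicator)
    finally show ?thesis .
  qed
  have le_step: "(LINT x|\<nu>. w x) \<le> measure \<nu> W + h"
  proof -
    have "(LINT x|\<nu>. w x) \<le> (LINT x|\<nu>. indicator W x + h)"
      using sets h unfolding w_def
      by (intro integral_mono int_step) (auto simp: emeasure_eq_measure split: split_indicator)
    also have "\<dots> = measure \<nu> W + h"
      using sets prob_space by (subst Bochner_Integration.integral_add) (auto simp: emeasure_eq_measure)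
    finally show ?thesis .
  qed
  have "u x powr (1 - t) * v y powr t * exp (- K * (t * (1 - t) / 2) * (dist x y)\<^sup>2) \<le> w z"
    if z: "z \<in> Z t x y" for x y z
  proof -
    have "u x powr (1 - t) * v y powr t \<le> w z"
    proof (cases "x \<in> A \<and> y \<in> B")
      case True
      then show ?thesis using ZW z by (auto simp: u_def v_def w_def)
    next
      case False
      have le1: "u x powr (1 - t) \<le> 1" "v y powr t \<le> 1"
        using e t by (auto simp: u_def v_def intro: powr_le1)
      have "u x powr (1 - t) \<le> h \<or> v y powr t \<le> h"
        using False e_powr s by (auto simp: u_def v_def)
      then have "u x powr (1 - t) * v y powr t \<le> h"
        using le1 h mult_mono[of "u x powr (1 - t)" h "v y powr t" 1]
          mult_mono[of "u x powr (1 - t)" 1 "v y powr t" h] by auto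
      also have "h \<le> w z" using h by (simp add: w_def)
      finally show ?thesis .
    qed
    moreover have "exp (- K * (t * (1 - t) / 2) * (dist x y)\<^sup>2) \<le> 1"
      using t \<open>0 \<le> K\<close> by simp
    ultimately show ?thesis
      by (metis exp_ge_zero mult_left_le mult_nonneg_nonneg order_trans powr_ge_zero)
  qed
  moreover have "0 < u x" "0 < v x" "0 < w x" for x
    using e h by (auto simp: u_def v_def w_def)
  moreover have "integrable \<nu> u" "integrable \<nu> v" "integrable \<nu> w"
    unfolding u_def v_def w_def using sets by (auto intro: int_step)
  ultimately have "(LINT x|\<nu>. u x) powr (1 - t) * (LINT x|\<nu>. v x) powr t \<le> (LINT x|\<nu>. w x)"
    using \<open>PL K \<nu>\<close> t by (intro PL_D[of K \<nu> t u v w]) auto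
  moreover have "measure \<nu> A powr (1 - t) * measure \<nu> B powr t
      \<le> (LINT x|\<nu>. u x) powr (1 - t) * (LINT x|\<nu>. v x) powr t"
    unfolding u_def v_def using t e sets by (intro mult_mono powr_mono2 ge_step) auto
  ultimately show "measure \<nu> A powr (1 - t) * measure \<nu> B powr t \<le> measure \<nu> W + \<eta>"
    using le_step h by linarith
qed

text \<open>
  Well-order the space and let \<open>l x\<close> be the first point at distance less than \<open>r\<close> from \<open>x\<close>. Of two
  points with different labels, the one with the later label is at distance at least \<open>r\<close> from the
  earlier label. This is the start of Stone's proof that metric spaces are paracompact.
\<close>

lemma first_near_point:
  fixes r :: real
  assumes "0 < r"
  obtains l :: "'a::metric_space \<Rightarrow> 'a" where "\<And>x. dist x (l x) < r"
    and "\<And>x y. l x \<noteq> l y \<Longrightarrow> r \<le> dist y (l x) \<or> r \<le> dist x (l y)"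
proof -
  obtain R :: "'a rel" where "Well_order R \<and> Field R = UNIV"
    by (rule exE[OF well_ordering])
  note R = conjunct1[OF this] conjunct2[OF this]
  have wf: "wf (R - Id)" and anti: "antisym R" and tot: "Total R" and refl: "Refl R"
    using R(1) unfolding well_order_on_def linear_order_on_def partial_order_on_def preorder_on_def
    by simp_all
  have "\<exists>c. dist x c < r \<and> (\<forall>b. dist x b < r \<longrightarrow> (c, b) \<in> R)" for x :: 'a
  proof -
    have "x \<in> ball x r" using assms by simp
    then obtain c where c: "c \<in> ball x r" "\<And>b. (b, c) \<in> R - Id \<Longrightarrow> b \<notin> ball x r"
      by (rule wfE_min[OF wf]) blast
    have "(c, b) \<in> R" if "dist x b < r" for b
    proof (cases "b = c")
      case True
      then show ?thesis using refl R(2) by (auto simp: refl_on_def)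
    next
      case False
      then show ?thesis using c(2)[of b] that tot R(2) by (auto simp: total_on_def)
    qed
    then show ?thesis using c(1) by auto
  qed
  then obtain l where l: "\<And>x. dist x (l x) < r" "\<And>x b. dist x b < r \<Longrightarrow> (l x, b) \<in> R"
    by metis
  have "r \<le> dist y (l x) \<or> r \<le> dist x (l y)" if "l x \<noteq> l y" for x y
  proof (rule ccontr)
    assume "\<not> (r \<le> dist y (l x) \<or> r \<le> dist x (l y))"
    then have "(l x, l y) \<in> R" "(l y, l x) \<in> R" using l(2) by auto
    then show False using anti that by (auto dest: antisymD)
  qed
  then show ?thesis using that l(1) by blast
qed

text \<open>
  Points that are \<open>\<delta>\<close>-deep in the ball around their label are \<open>\<delta>\<close>-separated when the labels
  differ. So a convergent sequence of such points has eventually constant labels, and every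
  set of labels, however large, has a closed preimage.
\<close>

lemma closed_label_preimage:
  fixes l :: "'a::metric_space \<Rightarrow> 'a"
  assumes lr: "\<And>x. dist x (l x) < r"
    and first: "\<And>x y. l x \<noteq> l y \<Longrightarrow> r \<le> dist y (l x) \<or> r \<le> dist x (l y)"
    and \<delta>: "0 < \<delta>"
  defines "E \<equiv> {x. dist x (l x) \<le> r - \<delta>}"
  shows "\<And>x y. x \<in> E \<Longrightarrow> y \<in> E \<Longrightarrow> l x \<noteq> l y \<Longrightarrow> \<delta> \<le> dist x y"
    and "closed (E \<inter> l -` J)"
proof -
  show sep: "\<delta> \<le> dist x y" if "x \<in> E" "y \<in> E" "l x \<noteq> l y" for x y
  proof -
    have "r \<le> dist y (l x) \<or> r \<le> dist x (l y)" by (rule first) fact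
    then show ?thesis
      using that dist_triangle[of y "l x" x] dist_triangle[of x "l y" y]
      by (auto simp: E_def dist_commute)
  qed
  show "closed (E \<inter> l -` J)"
    unfolding closed_sequential_limits
  proof (intro allI impI, elim conjE)
    fix X x assume X: "\<forall>n. X n \<in> E \<inter> l -` J" "X \<longlonglongrightarrow> x"
    obtain N where N: "\<And>n. n \<ge> N \<Longrightarrow> dist (X n) x < \<delta> / 2"
      using X(2) \<delta> by (meson half_gt_zero lim_sequentially)
    have same: "l (X n) = l (X N)" if "n \<ge> N" for n
    proof (rule ccontr)
      assume "l (X n) \<noteq> l (X N)"
      then have "\<delta> \<le> dist (X n) (X N)" using X(1) by (intro sep) auto
      also have "\<dots> \<le> dist (X n) x + dist (X N) x" by (rule dist_triangle2)
      finally show False using N[of n] N[of N] that by simp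
    qed
    define c where "c = l (X N)"
    have lim: "(\<lambda>n. dist (X n) c) \<longlonglongrightarrow> dist x c" by (intro tendsto_intros X)
    have "dist x c \<le> r - \<delta>"
    proof (rule tendsto_upperbound[OF lim])
      show "\<forall>\<^sub>F n in sequentially. dist (X n) c \<le> r - \<delta>"
        using eventually_ge_at_top[of N]
      proof eventually_elim
        case (elim n)
        have "X n \<in> E" using X(1) by blast
        then show ?case using same[OF elim] by (simp add: c_def E_def)
      qed
    qed simp
    have "l x = c"
    proof (rule ccontr)
      assume "l x \<noteq> c"
      have "(\<lambda>n. dist (X n) (l x)) \<longlonglongrightarrow> dist x (l x)" by (intro tendsto_intros X)
      then have "\<forall>\<^sub>F n in sequentially. dist (X n) (l x) < r"
        using lr order_tendstoD(2) by blast
      then have "\<forall>\<^sub>F n in sequentially. dist (X n) (l x) < r \<and> n \<ge> N"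
        using eventually_ge_at_top[of N] by eventually_elim simp
      then obtain n where n: "dist (X n) (l x) < r" "n \<ge> N"
        using eventually_happens by fastforce
      have "l (X n) = c" using same[OF n(2)] by (simp add: c_def)
      then have "r \<le> dist x c \<or> r \<le> dist (X n) (l x)"
        using first[of "X n" x] \<open>l x \<noteq> c\<close> by simp
      then show False using \<open>dist x c \<le> r - \<delta>\<close> \<delta> n by simp
    qed
    then show "x \<in> E \<inter> l -` J"
      using \<open>dist x c \<le> r - \<delta>\<close> X(1) by (auto simp: E_def c_def)
  qed
qed

text \<open>
  The labelling by the first near point has fibres of diameter at most \<open>\<epsilon>\<close>, and a bounded part \<open>G\<close>
  of \<open>F\<close> of positive measure \<open>m\<close> consists of \<open>\<delta>\<close>-separated fibres. No block being left, the image
  measure of \<open>G\<close> on the labels has no atoms, so the labels split into sets \<open>J i\<close> of mass at most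
  \<open>\<eta>\<close>. Transporting the part \<open>J i\<close> for a short time \<open>t\<close> towards a ball of mass \<open>b\<close> stays in its
  \<open>\<delta>/3\<close>-neighbourhood \<open>W i\<close>, so that \<open>\<nu> (W i) \<ge> p\<^sub>i\<^bsup>1-t\<^esup> b\<^bsup>t\<^esup>\<close> for the mass \<open>p\<^sub>i\<close> of the part. The
  sets \<open>W i\<close> are disjoint, and the right-hand side is at least \<open>2 p\<^sub>i / m\<close> for small \<open>\<eta>\<close>, which
  adds up to a total mass of at least \<open>2\<close>.
\<close>

lemma PL_no_diffuse_part:
  fixes \<nu> :: "'a::metric_space measure"
  assumes \<nu>: "borel_prob \<nu>" and PL: "PL K \<nu>" and "0 \<le> K" and "0 < \<epsilon>"
    and F: "F \<in> sets \<nu>"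
    and noblock: "\<And>G. block \<nu> \<epsilon> G \<Longrightarrow> G \<subseteq> F \<Longrightarrow> G \<in> null_sets \<nu>"
  shows "F \<in> null_sets \<nu>"
proof (rule ccontr)
  assume pos: "F \<notin> null_sets \<nu>"
  interpret prob_space \<nu> using \<nu> by (simp add: borel_prob_def)
  have sets\<nu>[simp]: "sets \<nu> = sets borel" and sp[simp]: "space \<nu> = UNIV"
    using \<nu> sets_eq_imp_space_eq[of \<nu> borel] by (auto simp: borel_prob_def)
  obtain l :: "'a \<Rightarrow> 'a" where lr: "\<And>x. dist x (l x) < \<epsilon> / 2"
    and first: "\<And>x y. l x \<noteq> l y \<Longrightarrow> \<epsilon> / 2 \<le> dist y (l x) \<or> \<epsilon> / 2 \<le> dist x (l y)"
    using first_near_point[of "\<epsilon> / 2"] \<open>0 < \<epsilon>\<close> by auto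
  define E where "E n = {x. dist x (l x) \<le> \<epsilon> / 2 - 1 / Suc n}" for n :: nat
  have closed: "closed (E n \<inter> l -` J)" for n J
    unfolding E_def by (rule closed_label_preimage(2)[OF lr first]) auto
  have sep: "1 / Suc n \<le> dist x y" if "x \<in> E n" "y \<in> E n" "l x \<noteq> l y" for n x y
    using closed_label_preimage(1)[OF lr first, of "1 / Suc n"] that unfolding E_def by auto
  fix x0 :: 'a
  have "\<exists>n. F \<inter> ball x0 (Suc n) \<inter> E n \<notin> null_sets \<nu>"
  proof (rule ccontr)
    assume "\<nexists>n. F \<inter> ball x0 (Suc n) \<inter> E n \<notin> null_sets \<nu>"
    then have "(\<Union>n. F \<inter> ball x0 (Suc n) \<inter> E n) \<in> null_sets \<nu>" by (intro null_sets_UN) blast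
    moreover have "(\<Union>n. F \<inter> ball x0 (Suc n) \<inter> E n) = F"
    proof -
      have "\<exists>n. dist x0 x < Suc n \<and> dist x (l x) \<le> \<epsilon> / 2 - 1 / Suc n" for x
      proof -
        obtain m where m: "dist x0 x < real m" using reals_Archimedean2 by blast
        obtain k where k: "1 / Suc k < \<epsilon> / 2 - dist x (l x)"
          using lr[of x] nat_approx_posE[of "\<epsilon> / 2 - dist x (l x)"] by auto
        have "1 / real (Suc (max m k)) \<le> 1 / Suc k" by (intro divide_left_mono) auto
        then show ?thesis using m k by (intro exI[of _ "max m k"]) auto
      qed
      then show ?thesis by (auto simp: E_def)
    qed
    ultimately show False using pos by simp
  qed
  then obtain n where n: "F \<inter> ball x0 (Suc n) \<inter> E n \<notin> null_sets \<nu>" by blast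
  define G where "G = F \<inter> ball x0 (Suc n) \<inter> E n"
  define \<delta> where "\<delta> = 1 / real (Suc n)"
  define R where "R = real (Suc n)"
  have \<delta>: "0 < \<delta>" and R: "0 < R" by (auto simp: \<delta>_def R_def)
  have GJ: "G \<inter> l -` J \<in> sets borel" for J
  proof -
    have "F \<inter> ball x0 (Suc n) \<inter> (E n \<inter> l -` J) \<in> sets borel"
      using F borel_closed[OF closed[of n J]] by auto
    then show ?thesis by (simp add: G_def Int_assoc)
  qed
  have Gm: "G \<in> sets borel" using GJ[of UNIV] by simp
  define M where "M = distr (restrict_space \<nu> G) (count_space UNIV) l"
  have l_meas: "l \<in> measurable (restrict_space \<nu> G) (count_space UNIV)"
    using GJ Gm by (intro measurableI) (auto simp: sets_restrict_space space_restrict_space Int_commute)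
  have M: "emeasure M J = emeasure \<nu> (G \<inter> l -` J)" for J
    using GJ Gm unfolding M_def
    by (subst emeasure_distr[OF l_meas])
      (auto simp: space_restrict_space emeasure_restrict_space Int_commute)
  have nullM: "J \<in> null_sets M \<longleftrightarrow> G \<inter> l -` J \<in> null_sets \<nu>" for J
    using GJ M by (auto simp: null_sets_def M_def)
  have "finite_measure M"
    using M by (intro finite_measureI) (auto simp: M_def)
  define m where "m = measure \<nu> G"
  define b where "b = measure \<nu> (ball x0 R)"
  \<comment> \<open>points of the ball of radius \<open>R\<close> are less than \<open>2 R\<close> apart, and \<open>2 R t < \<delta> / 3\<close>\<close>
  define t where "t = \<delta> / (6 * R + 6 * \<delta>)"
  have t: "0 < t" "t < 1" using \<delta> R by (auto simp: t_def field_simps)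
  have "G \<notin> null_sets \<nu>" using n unfolding G_def .
  then have m: "0 < m"
    using Gm by (auto simp: m_def null_sets_def emeasure_eq_measure zero_less_measure_iff)
  have "m \<le> b" unfolding m_def b_def by (intro finite_measure_mono) (auto simp: G_def R_def)
  then have b: "0 < b" using m by simp
  \<comment> \<open>the value for which \<open>(b / \<eta>)\<^bsup>t\<^esup> = 2 / m\<close>\<close>
  define \<eta> where "\<eta> = b * (m / 2) powr (1 / t)"
  have \<eta>: "0 < \<eta>" using m b by (simp add: \<eta>_def)
  obtain J :: "nat \<Rightarrow> 'a set" where J: "disjoint_family J" "\<And>i. measure M (J i) \<le> \<eta>"
      "space M - (\<Union>i. J i) \<in> null_sets M"
  proof (rule atomless_small_pieces[OF \<open>finite_measure M\<close> _ \<eta>])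
    fix J assume J: "J \<notin> null_sets M"
    show "\<exists>H\<in>sets M. H \<subseteq> J \<and> H \<notin> null_sets M \<and> J - H \<notin> null_sets M"
    proof (rule ccontr)
      assume no: "\<not> (\<exists>H\<in>sets M. H \<subseteq> J \<and> H \<notin> null_sets M \<and> J - H \<notin> null_sets M)"
      have "block \<nu> \<epsilon> (G \<inter> l -` J)"
        unfolding block_def
      proof (intro conjI exI[of _ l] ballI allI impI)
        show "G \<inter> l -` J \<in> sets \<nu>" using GJ by simp
        show "dist x y \<le> \<epsilon>" if "l x = l y" for x y
          using lr[of x] lr[of y] that dist_triangle2[of x y "l x"] by simp
        fix H
        have "J \<inter> H \<in> null_sets M \<or> J - J \<inter> H \<in> null_sets M"
          using no by (auto simp: M_def)
        then show "G \<inter> l -` J \<inter> l -` H \<in> null_sets \<nu> \<or> G \<inter> l -` J - l -` H \<in> null_sets \<nu>"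
          unfolding nullM by (simp add: Int_assoc vimage_Diff Int_Diff Diff_Int)
      qed
      then show False using noblock[of "G \<inter> l -` J"] J nullM by (auto simp: G_def)
    qed
  qed blast
  define W where "W i = (\<Union>x\<in>G \<inter> l -` J i. ball x (\<delta> / 3))" for i
  have W: "W i \<in> sets borel" for i unfolding W_def by (intro borel_open) auto
  have "disjoint_family W"
    unfolding disjoint_family_on_def
  proof (intro ballI impI)
    fix i j :: nat assume ij: "i \<noteq> j"
    show "W i \<inter> W j = {}"
    proof (rule ccontr)
      assume "W i \<inter> W j \<noteq> {}"
      then obtain x y z where xyz: "x \<in> G" "l x \<in> J i" "y \<in> G" "l y \<in> J j"
          "dist x z < \<delta> / 3" "dist y z < \<delta> / 3"
        unfolding W_def by auto
      have "J i \<inter> J j = {}" using J(1) ij by (simp add: disjoint_family_on_def)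
      then have "l x \<noteq> l y" using xyz by auto
      then have "\<delta> \<le> dist x y" using sep[of x n y] xyz by (auto simp: G_def \<delta>_def)
      then show False using dist_triangle2[of x y z] xyz \<delta> by simp
    qed
  qed
  have key: "2 / m * measure M (J i) \<le> measure \<nu> (W i)" for i
  proof (cases "measure M (J i) = 0")
    case False
    define p where "p = measure \<nu> (G \<inter> l -` J i)"
    have p_eq: "measure M (J i) = p" using M by (simp add: p_def measure_def)
    have p: "0 < p" "p \<le> \<eta>" using False J(2)[of i] p_eq by (auto simp: p_def zero_less_measure_iff)
    have "p powr (1 - t) * b powr t \<le> measure \<nu> (W i)"
      unfolding p_def b_def
    proof (rule PL_interpolation_sets[OF \<nu> PL \<open>0 \<le> K\<close> GJ _ W t])
      fix x y assume x: "x \<in> G \<inter> l -` J i" and y: "y \<in> ball x0 R"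
      show "Z t x y \<subseteq> W i"
      proof
        fix z assume "z \<in> Z t x y"
        have "dist x y < 2 * R"
          using x y dist_triangle2[of x y x0] by (auto simp: G_def R_def dist_commute)
        then have "t * dist x y < t * (2 * R)" using t by simp
        also have "\<dots> < \<delta> / 3" using \<delta> R by (simp add: t_def field_simps)
        finally have "dist x z < \<delta> / 3" using \<open>z \<in> Z t x y\<close> by (simp add: Z_def)
        then show "z \<in> W i" using x unfolding W_def by auto
      qed
    qed simp
    moreover have "2 / m * p \<le> p powr (1 - t) * b powr t"
    proof -
      have "2 / m = \<eta> powr (- t) * b powr t"
        using m b t by (simp add: \<eta>_def powr_mult powr_powr powr_minus field_simps)
      also have "\<dots> \<le> p powr (- t) * b powr t"
        using p t by (intro mult_right_mono powr_mono2') auto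
      finally have "2 / m * p \<le> (p powr (- t) * b powr t) * p"
        using p by (intro mult_right_mono) auto
      also have "\<dots> = p powr (1 - t) * b powr t"
        using p by (simp add: powr_diff powr_minus field_simps)
      finally show ?thesis .
    qed
    ultimately show ?thesis by (simp add: p_eq)
  qed auto
  have "(\<lambda>i. measure M (J i)) sums m"
  proof -
    interpret M: finite_measure M by fact
    have "(\<lambda>i. measure M (J i)) sums measure M (\<Union>i. J i)"
      using J(1) by (intro M.finite_measure_UNION) (auto simp: M_def)
    moreover have "measure M (\<Union>i. J i) = measure M (space M)"
      using M.finite_measure_compl[of "\<Union>i. J i"] measure_eq_0_null_sets[OF J(3)]
      by (simp add: M_def)
    moreover have "measure M (space M) = m" by (simp add: measure_def M m_def) (simp add: M_def)
    ultimately show ?thesis by simp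
  qed
  then have "(\<lambda>i. 2 / m * measure M (J i)) sums (2 / m * m)" by (rule sums_mult)
  moreover have "(\<lambda>i. measure \<nu> (W i)) sums measure \<nu> (\<Union>i. W i)"
    using \<open>disjoint_family W\<close> W by (intro finite_measure_UNION) auto
  ultimately have "2 / m * m \<le> measure \<nu> (\<Union>i. W i)"
    using key by (rule sums_le[rotated])
  then show False using m prob_le_1[of "\<Union>i. W i"] by simp
qed

text \<open>
  The block number \<open>c\<close> is given by the first block of an exhausting sequence that contains the
  point; on the null set \<open>N\<close> that no block reaches its value is arbitrary.
\<close>

lemma PL_block_partition:
  fixes \<nu> :: "'a::metric_space measure"
  assumes \<nu>: "borel_prob \<nu>" and "PL K \<nu>" "0 \<le> K" "0 < \<epsilon>"
  obtains c :: "'a \<Rightarrow> nat" and N where "c \<in> measurable borel (count_space UNIV)"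
    and "N \<in> null_sets \<nu>" and "\<And>n. block \<nu> \<epsilon> (c -` {n} - N)"
proof -
  interpret prob_space \<nu> using \<nu> by (simp add: borel_prob_def)
  have [simp]: "sets \<nu> = sets borel" and [simp]: "space \<nu> = UNIV"
    using \<nu> sets_eq_imp_space_eq[of \<nu> borel] by (auto simp: borel_prob_def)
  have "{G. block \<nu> \<epsilon> G} \<subseteq> sets \<nu>" "{} \<in> {G. block \<nu> \<epsilon> G}"
    by (auto simp: block_def)
  then obtain A :: "nat \<Rightarrow> 'a set" where A: "range A \<subseteq> {G. block \<nu> \<epsilon> G}"
    and rest: "\<And>G. G \<in> {G. block \<nu> \<epsilon> G} \<Longrightarrow> G \<inter> (\<Union>n. A n) = {} \<Longrightarrow> G \<in> null_sets \<nu>"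
    using exhaustion[OF finite_measure_axioms] by blast
  have blockA: "block \<nu> \<epsilon> (A n)" for n using A by blast
  then have [measurable]: "A n \<in> sets borel" for n by (auto simp: block_def)
  define N where "N = UNIV - (\<Union>n. A n)"
  have N: "N \<in> null_sets \<nu>"
    using \<nu> \<open>PL K \<nu>\<close> \<open>0 \<le> K\<close> \<open>0 < \<epsilon>\<close>
  proof (rule PL_no_diffuse_part)
    show "N \<in> sets \<nu>" by (auto simp: N_def)
    show "G \<in> null_sets \<nu>" if "block \<nu> \<epsilon> G" "G \<subseteq> N" for G
      using rest[of G] that by (auto simp: N_def)
  qed
  define c where "c x = (LEAST n. x \<in> A n)" for x
  have c_meas: "c \<in> measurable borel (count_space UNIV)"
    unfolding c_def by measurable
  show ?thesis
  proof (rule that[OF c_meas N])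
    fix n
    have "c -` {n} - N \<subseteq> A n"
      unfolding c_def N_def by (auto intro: LeastI)
    moreover have "c -` {n} - N \<in> sets \<nu>"
      using measurable_sets[OF c_meas, of "{n}"] N by auto
    ultimately show "block \<nu> \<epsilon> (c -` {n} - N)"
      by (rule block_subset[OF blockA])
  qed
qed

section \<open>The dual transportation inequality\<close>

text \<open>
  Prekopa-Leindler for \<open>exp (- K t f)\<close>, \<open>exp (K (1 - t) g)\<close> and \<open>1\<close>, where the first integral
  is bounded below by Jensen's inequality.
\<close>

lemma PL_dual_exp:
  fixes \<nu> :: "'a::metric_space measure" and f g :: "'a \<Rightarrow> real"
  assumes \<nu>: "borel_prob \<nu>" and PL: "PL K \<nu>" and K: "0 < K"
    and f: "f \<in> borel_measurable borel" "\<And>x. \<bar>f x\<bar> \<le> L"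
    and g: "g \<in> borel_measurable borel" "\<And>x. \<bar>g x\<bar> \<le> L"
    and fg: "\<And>x y. g y - f x \<le> (dist x y)\<^sup>2 / 2"
    and t: "0 < t" "t < 1"
  shows "(LINT x|\<nu>. exp (K * (1 - t) * g x)) \<le> exp (K * (1 - t) * (LINT x|\<nu>. f x))"
proof -
  interpret prob_space \<nu> using \<nu> by (simp add: borel_prob_def)
  have sets\<nu>: "sets \<nu> = sets borel" using \<nu> by (simp add: borel_prob_def)
  have bounded_int: "integrable \<nu> h"
    if "h \<in> borel_measurable borel" "\<And>x. \<bar>h x\<bar> \<le> B" for h :: "'a \<Rightarrow> real" and B
    using that by (intro integrable_const_bound[of _ B])
      (auto simp: measurable_cong_sets[OF sets\<nu> refl])
  have exp_int: "integrable \<nu> (\<lambda>x. exp (c * h x))"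
    if h: "h \<in> borel_measurable borel" "\<And>x. \<bar>h x\<bar> \<le> L" for h and c :: real
  proof (rule bounded_int[of _ "exp (\<bar>c\<bar> * L)"])
    show "(\<lambda>x. exp (c * h x)) \<in> borel_measurable borel" using h(1) by measurable
    show "\<bar>exp (c * h x)\<bar> \<le> exp (\<bar>c\<bar> * L)" for x
    proof -
      have "c * h x \<le> \<bar>c\<bar> * \<bar>h x\<bar>" by (metis abs_ge_self abs_mult)
      also have "\<dots> \<le> \<bar>c\<bar> * L" using h(2) by (intro mult_left_mono) auto
      finally show ?thesis by simp
    qed
  qed
  define m where "m = (LINT x|\<nu>. f x)"
  define I where "I = (LINT x|\<nu>. exp (K * (1 - t) * g x))"
  have int_f: "integrable \<nu> f" by (rule bounded_int[OF f])
  have "(LINT x|\<nu>. exp (- (K * t) * f x)) powr (1 - t) * I powr t \<le> (LINT x|\<nu>. 1)"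
    unfolding I_def
  proof (rule PL_D[OF PL])
    show "integrable \<nu> (\<lambda>x. exp (- (K * t) * f x))" by (intro exp_int f)
    show "integrable \<nu> (\<lambda>x. exp (K * (1 - t) * g x))" by (intro exp_int g)
    fix x y z
    have "exp (- (K * t) * f x) powr (1 - t) * exp (K * (1 - t) * g y) powr t
        * exp (- K * (t * (1 - t) / 2) * (dist x y)\<^sup>2)
        = exp (K * t * (1 - t) * (g y - f x - (dist x y)\<^sup>2 / 2))"
      by (simp add: powr_def flip: exp_add) (simp add: field_simps)
    also have "\<dots> \<le> 1"
      using fg[of y x] K t by (simp add: mult_nonneg_nonpos)
    finally show "exp (- (K * t) * f x) powr (1 - t) * exp (K * (1 - t) * g y) powr t
        * exp (- K * (t * (1 - t) / 2) * (dist x y)\<^sup>2) \<le> 1" .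
  qed (use t in auto)
  also have "\<dots> = 1" by (simp add: prob_space)
  finally have le1: "(LINT x|\<nu>. exp (- (K * t) * f x)) powr (1 - t) * I powr t \<le> 1" .
  have jensen: "exp (- (K * t) * m) \<le> (LINT x|\<nu>. exp (- (K * t) * f x))"
  proof -
    \<comment> \<open>the tangent of \<open>exp\<close> at the mean\<close>
    have "exp (- (K * t) * m) = (LINT x|\<nu>. exp (- (K * t) * m) * (1 + - (K * t) * (f x - m)))"
      using int_f by (simp add: m_def prob_space)
    also have "\<dots> \<le> (LINT x|\<nu>. exp (- (K * t) * f x))"
    proof (rule integral_mono)
      show "integrable \<nu> (\<lambda>x. exp (- (K * t) * m) * (1 + - (K * t) * (f x - m)))"
        using int_f by (intro integrable_mult_right Bochner_Integration.integrable_add Bochner_Integration.integrable_diff) auto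
      show "integrable \<nu> (\<lambda>x. exp (- (K * t) * f x))" by (intro exp_int f)
      fix x
      have "1 + - (K * t) * (f x - m) \<le> exp (- (K * t) * (f x - m))" by (rule exp_ge_add_one_self)
      then have "exp (- (K * t) * m) * (1 + - (K * t) * (f x - m))
          \<le> exp (- (K * t) * m) * exp (- (K * t) * (f x - m))" by (intro mult_left_mono) auto
      also have "\<dots> = exp (- (K * t) * f x)" by (simp add: algebra_simps flip: exp_add)
      finally show "exp (- (K * t) * m) * (1 + - (K * t) * (f x - m)) \<le> exp (- (K * t) * f x)" .
    qed
    finally show ?thesis .
  qed
  have "0 \<le> I" unfolding I_def by (intro integral_nonneg_AE) auto
  show ?thesis
  proof (cases "I = 0")
    case True
    then show ?thesis by (simp add: I_def)
  next
    case False
    have "exp (- (K * t) * m) powr (1 - t) * I powr t \<le> 1"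
      using jensen t by (intro order_trans[OF mult_right_mono le1] powr_mono2) auto
    then have "ln (exp (- (K * t) * m) powr (1 - t) * I powr t) \<le> 0"
      using False \<open>0 \<le> I\<close> by (subst ln_le_zero_iff) auto
    then have "t * ln I \<le> t * (K * (1 - t) * m)"
      using False \<open>0 \<le> I\<close> by (simp add: ln_mult ln_powr algebra_simps)
    then have "ln I \<le> K * (1 - t) * m" using t by simp
    then have "exp (ln I) \<le> exp (K * (1 - t) * m)" by simp
    then have "I \<le> exp (K * (1 - t) * m)" using False \<open>0 \<le> I\<close> by simp
    then show ?thesis by (simp add: I_def m_def)
  qed
qed

text \<open>
  The easy half of the variational formula for the entropy: integrate Young's inequality
  \<open>\<rho> s + \<rho> - exp s \<le> \<rho> ln \<rho>\<close> at \<open>s = h x - c\<close>.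
\<close>

lemma donsker_varadhan:
  fixes \<rho> h :: "'a \<Rightarrow> real"
  assumes "prob_space \<nu>" and \<rho>: "\<rho> \<in> borel_measurable \<nu>" "\<And>x. 0 \<le> \<rho> x"
    and \<mu>: "prob_space (density \<nu> \<rho>)"
    and ent: "integrable \<nu> (\<lambda>x. \<rho> x * ln (\<rho> x))"
    and h: "h \<in> borel_measurable \<nu>" "\<And>x. \<bar>h x\<bar> \<le> L"
    and exp: "(LINT x|\<nu>. exp (h x)) \<le> exp c"
  shows "(LINT x|density \<nu> \<rho>. h x) - c \<le> (LINT x|\<nu>. \<rho> x * ln (\<rho> x))"
proof -
  interpret prob_space \<nu> by fact
  interpret \<mu>: prob_space "density \<nu> \<rho>" by fact
  have int_\<rho>: "integrable \<nu> \<rho>" and int1: "(LINT x|\<nu>. \<rho> x) = 1"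
  proof -
    have "integrable (density \<nu> \<rho>) (\<lambda>_. 1 :: real)" by simp
    then show "integrable \<nu> \<rho>" using \<rho> by (subst (asm) integrable_density) auto
    have "(LINT x|density \<nu> \<rho>. 1) = (1 :: real)" using \<mu>.prob_space by simp
    then show "(LINT x|\<nu>. \<rho> x) = 1" using \<rho> by (subst (asm) integral_density) auto
  qed
  have int_h: "integrable \<nu> (\<lambda>x. \<rho> x * h x)"
  proof -
    have "integrable (density \<nu> \<rho>) h"
      using h \<rho> by (intro \<mu>.integrable_const_bound[of _ L]) auto
    then show ?thesis using \<rho> h by (subst (asm) integrable_density) auto
  qed
  have int_exp: "integrable \<nu> (\<lambda>x. exp (h x))"
    using h by (intro integrable_const_bound[of _ "exp L"]) (auto intro: order_trans[OF abs_ge_self])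
  have young: "\<rho> x * (h x - c) + \<rho> x - exp (h x) * exp (- c) \<le> \<rho> x * ln (\<rho> x)" for x
  proof (cases "\<rho> x = 0")
    case False
    then have "0 < \<rho> x" using \<rho>(2)[of x] by simp
    have "1 + (h x - c - ln (\<rho> x)) \<le> exp (h x - c - ln (\<rho> x))" by (rule exp_ge_add_one_self)
    then have "\<rho> x * (1 + (h x - c - ln (\<rho> x))) \<le> \<rho> x * exp (h x - c - ln (\<rho> x))"
      using \<open>0 < \<rho> x\<close> by (intro mult_left_mono) auto
    also have "\<dots> = exp (h x) * exp (- c)"
      using \<open>0 < \<rho> x\<close> by (simp add: exp_diff exp_minus divide_simps)
    finally show ?thesis by (simp add: algebra_simps)
  qed simp
  have "(LINT x|density \<nu> \<rho>. h x) - c \<le> (LINT x|density \<nu> \<rho>. h x) - c + 1 - (LINT x|\<nu>. exp (h x)) * exp (- c)"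
    using mult_right_mono[OF exp, of "exp (- c)"] by (simp flip: exp_add)
  also have "\<dots> = (LINT x|\<nu>. \<rho> x * (h x - c) + \<rho> x - exp (h x) * exp (- c))"
    using int_h int_\<rho> int_exp int1 \<rho> h
    by (simp add: integral_density right_diff_distrib)
  also have "\<dots> \<le> (LINT x|\<nu>. \<rho> x * ln (\<rho> x))"
    using int_h int_\<rho> int_exp ent young by (intro integral_mono) (auto simp: right_diff_distrib)
  finally show ?thesis .
qed

text \<open>
  The two preceding bounds for the potential \<open>K (1 - t) g\<close>, in the limit \<open>t \<rightarrow> 0\<close>.
\<close>

lemma PL_dual_entropy:
  fixes \<nu> :: "'a::metric_space measure" and f g \<rho> :: "'a \<Rightarrow> real"
  assumes \<nu>: "borel_prob \<nu>" and PL: "PL K \<nu>" and K: "0 < K"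
    and \<rho>: "\<rho> \<in> borel_measurable borel" "\<And>x. 0 \<le> \<rho> x"
    and \<mu>: "prob_space (density \<nu> \<rho>)"
    and ent: "integrable \<nu> (\<lambda>x. \<rho> x * ln (\<rho> x))"
    and f: "f \<in> borel_measurable borel" "\<And>x. \<bar>f x\<bar> \<le> L"
    and g: "g \<in> borel_measurable borel" "\<And>x. \<bar>g x\<bar> \<le> L"
    and fg: "\<And>x y. g y - f x \<le> (dist x y)\<^sup>2 / 2"
  shows "K * ((LINT x|density \<nu> \<rho>. g x) - (LINT x|\<nu>. f x)) \<le> (LINT x|\<nu>. \<rho> x * ln (\<rho> x))"
proof -
  have sets\<nu>: "sets \<nu> = sets borel" using \<nu> by (simp add: borel_prob_def)
  define D where "D = K * ((LINT x|density \<nu> \<rho>. g x) - (LINT x|\<nu>. f x))"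
  have "(1 - t) * D \<le> (LINT x|\<nu>. \<rho> x * ln (\<rho> x))" if t: "0 < t" "t < 1" for t
  proof -
    have "(LINT x|density \<nu> \<rho>. K * (1 - t) * g x) - K * (1 - t) * (LINT x|\<nu>. f x)
        \<le> (LINT x|\<nu>. \<rho> x * ln (\<rho> x))"
    proof (rule donsker_varadhan[OF _ _ \<rho>(2) \<mu> ent])
      show "prob_space \<nu>" using \<nu> by (simp add: borel_prob_def)
      show "\<rho> \<in> borel_measurable \<nu>" "(\<lambda>x. K * (1 - t) * g x) \<in> borel_measurable \<nu>"
        using \<rho> g by (auto simp: measurable_cong_sets[OF sets\<nu> refl])
      show "\<bar>K * (1 - t) * g x\<bar> \<le> K * (1 - t) * L" for x
        using K t g(2)[of x] by (simp add: abs_mult mult_left_mono)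
      show "(LINT x|\<nu>. exp (K * (1 - t) * g x)) \<le> exp (K * (1 - t) * (LINT x|\<nu>. f x))"
        by (rule PL_dual_exp[OF \<nu> PL K f g fg t])
    qed
    moreover have "(LINT x|density \<nu> \<rho>. K * (1 - t) * g x) = K * (1 - t) * (LINT x|density \<nu> \<rho>. g x)"
      by (rule integral_mult_right_zero)
    ultimately show ?thesis by (simp add: D_def algebra_simps)
  qed
  moreover have "((\<lambda>t. (1 - t) * D) \<longlongrightarrow> (1 - 0) * D) (at_right 0)"
    by (intro tendsto_intros)
  moreover have "eventually (\<lambda>t::real. 0 < t \<and> t < 1) (at_right 0)"
    by (intro eventually_conj eventually_at_right_less eventually_at_rightI[of 0 1]) auto
  ultimately have "(1 - 0) * D \<le> (LINT x|\<nu>. \<rho> x * ln (\<rho> x))"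
    by (intro tendsto_upperbound) (auto elim: eventually_mono)
  then show ?thesis by (simp add: D_def)
qed

section \<open>Essential distances and cell masses\<close>

text \<open>
  The distance between \<open>A\<close> and \<open>B\<close> up to null sets. The supremum would be that of an unbounded
  set if one of them is null; the value \<open>0\<close> keeps the function nonnegative.
\<close>

definition ess_dist :: "'a::metric_space measure \<Rightarrow> 'a set \<Rightarrow> 'a set \<Rightarrow> real" where
  "ess_dist \<nu> A B = (if A \<in> null_sets \<nu> \<or> B \<in> null_sets \<nu> then 0
     else Sup {s. \<exists>N\<in>null_sets \<nu>. \<forall>x\<in>A - N. \<forall>y\<in>B - N. s \<le> dist x y})"

text \<open>
  The supremum is finite because bounded non-null parts of \<open>A\<close> and \<open>B\<close> reach outside every null
  set, and attained because the null sets belonging to a sequence of admissible bounds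
  form one null set.
\<close>

lemma ess_dist:
  fixes \<nu> :: "'a::metric_space measure"
  assumes \<nu>: "sets \<nu> = sets borel" and AB: "A \<in> sets \<nu>" "B \<in> sets \<nu>"
  shows ess_dist_nonneg: "0 \<le> ess_dist \<nu> A B"
    and ess_dist_attained: "\<exists>N\<in>null_sets \<nu>. \<forall>x\<in>A - N. \<forall>y\<in>B - N. ess_dist \<nu> A B \<le> dist x y"
    and ess_dist_greatest: "\<And>s N. A \<notin> null_sets \<nu> \<Longrightarrow> B \<notin> null_sets \<nu> \<Longrightarrow> N \<in> null_sets \<nu> \<Longrightarrow>
      (\<And>x y. x \<in> A - N \<Longrightarrow> y \<in> B - N \<Longrightarrow> s \<le> dist x y) \<Longrightarrow> s \<le> ess_dist \<nu> A B"
proof -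
  define S where "S = {s. \<exists>N\<in>null_sets \<nu>. \<forall>x\<in>A - N. \<forall>y\<in>B - N. s \<le> dist x y}"
  have "0 \<in> S" unfolding S_def by (auto intro: bexI[of _ "{}"])
  have bdd: "bdd_above S" if nn: "A \<notin> null_sets \<nu>" "B \<notin> null_sets \<nu>"
  proof -
    fix x0 :: 'a
    have "\<exists>R. C \<inter> ball x0 (real R) \<notin> null_sets \<nu>" if "C \<in> sets \<nu>" "C \<notin> null_sets \<nu>" for C
    proof (rule ccontr)
      assume "\<nexists>R. C \<inter> ball x0 (real R) \<notin> null_sets \<nu>"
      then have "(\<Union>R. C \<inter> ball x0 (real R)) \<in> null_sets \<nu>" by (intro null_sets_UN) blast
      moreover have "(\<Union>R. C \<inter> ball x0 (real R)) = C"
        using reals_Archimedean2 by auto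
      ultimately show False using that by simp
    qed
    then obtain R1 R2 where R: "A \<inter> ball x0 (real R1) \<notin> null_sets \<nu>" "B \<inter> ball x0 (real R2) \<notin> null_sets \<nu>"
      using nn AB by metis
    have "s \<le> real R1 + real R2" if "s \<in> S" for s
    proof -
      obtain N where N: "N \<in> null_sets \<nu>" "\<forall>x\<in>A - N. \<forall>y\<in>B - N. s \<le> dist x y"
        using \<open>s \<in> S\<close> unfolding S_def by blast
      have meets: "\<exists>x. x \<in> C \<inter> ball x0 r - N"
        if "C \<in> sets \<nu>" "C \<inter> ball x0 r \<notin> null_sets \<nu>" for C r
      proof (rule ccontr)
        assume "\<nexists>x. x \<in> C \<inter> ball x0 r - N"
        then have "C \<inter> ball x0 r \<subseteq> N" by blast
        moreover have "C \<inter> ball x0 r \<in> sets \<nu>" using that \<nu> by auto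
        ultimately show False using null_sets_subset[OF N(1)] that by blast
      qed
      obtain x y where x: "x \<in> A \<inter> ball x0 (real R1) - N" and y: "y \<in> B \<inter> ball x0 (real R2) - N"
        using meets R AB by meson
      then have "s \<le> dist x y" using N(2) by blast
      also have "\<dots> \<le> dist x0 x + dist x0 y" by (rule dist_triangle3)
      finally show ?thesis using x y by auto
    qed
    then show ?thesis by (rule bdd_aboveI)
  qed
  show "0 \<le> ess_dist \<nu> A B"
    using \<open>0 \<in> S\<close> bdd cSup_upper[of 0 S] by (auto simp: ess_dist_def S_def[symmetric])
  show "s \<le> ess_dist \<nu> A B"
    if "A \<notin> null_sets \<nu>" "B \<notin> null_sets \<nu>" "N \<in> null_sets \<nu>"
      "\<And>x y. x \<in> A - N \<Longrightarrow> y \<in> B - N \<Longrightarrow> s \<le> dist x y" for s N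
  proof -
    have "s \<in> S" using that unfolding S_def by blast
    then show ?thesis using bdd that(1,2) by (auto simp: ess_dist_def S_def[symmetric] intro: cSup_upper)
  qed
  show "\<exists>N\<in>null_sets \<nu>. \<forall>x\<in>A - N. \<forall>y\<in>B - N. ess_dist \<nu> A B \<le> dist x y"
  proof (cases "A \<in> null_sets \<nu> \<or> B \<in> null_sets \<nu>")
    case True
    then show ?thesis by (intro bexI[of _ "{}"]) (auto simp: ess_dist_def)
  next
    case False
    have "\<exists>N\<in>null_sets \<nu>. \<forall>x\<in>A - N. \<forall>y\<in>B - N. Sup S - 1 / Suc n \<le> dist x y" for n
    proof -
      have "Sup S - 1 / Suc n < Sup S" by simp
      then obtain s where "s \<in> S" "Sup S - 1 / Suc n < s"
        using \<open>0 \<in> S\<close> less_cSupD[of S] by blast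
      then obtain N where N: "N \<in> null_sets \<nu>" "\<forall>x\<in>A - N. \<forall>y\<in>B - N. s \<le> dist x y"
        unfolding S_def by blast
      then have "\<forall>x\<in>A - N. \<forall>y\<in>B - N. Sup S - 1 / Suc n \<le> dist x y"
        using less_imp_le[OF \<open>Sup S - 1 / Suc n < s\<close>] order_trans by blast
      then show ?thesis using N(1) by blast
    qed
    then obtain N where N: "\<And>n. N n \<in> null_sets \<nu>"
        "\<And>n x y. x \<in> A - N n \<Longrightarrow> y \<in> B - N n \<Longrightarrow> Sup S - 1 / Suc n \<le> dist x y"
      by metis
    have "Sup S \<le> dist x y" if "x \<in> A - (\<Union>n. N n)" "y \<in> B - (\<Union>n. N n)" for x y
    proof (rule field_le_epsilon)
      fix e :: real assume "0 < e"
      then obtain n where "inverse (real (Suc n)) < e" using reals_Archimedean by blast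
      then have "1 / Suc n < e" by (simp add: inverse_eq_divide)
      then show "Sup S \<le> dist x y + e" using N(2)[of x n y] that by auto
    qed
    moreover have "(\<Union>n. N n) \<in> null_sets \<nu>" using N(1) by (rule null_sets_UN)
    moreover have "ess_dist \<nu> A B = Sup S" using False by (simp add: ess_dist_def S_def)
    ultimately show ?thesis by (intro bexI[of _ "\<Union>n. N n"]) auto
  qed
qed

lemma nn_integral_cells:
  fixes G :: "nat \<Rightarrow> ennreal"
  assumes c: "c \<in> measurable M (count_space UNIV)"
  shows "(\<integral>\<^sup>+x. G (c x) \<partial>M) = (\<Sum>i. G i * emeasure M (c -` {i} \<inter> space M))"
proof -
  have cell: "c -` {i} \<inter> space M \<in> sets M" for i
    using c by (rule measurable_sets) auto
  have "(\<integral>\<^sup>+x. G (c x) \<partial>M) = (\<integral>\<^sup>+x. (\<Sum>i. G i * indicator (c -` {i} \<inter> space M) x) \<partial>M)"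
  proof (rule nn_integral_cong)
    fix x assume "x \<in> space M"
    then have "(\<Sum>i. G i * indicator (c -` {i} \<inter> space M) x)
        = (\<Sum>i\<in>{c x}. G i * indicator (c -` {i} \<inter> space M) x)"
      by (intro suminf_finite) auto
    then show "G (c x) = (\<Sum>i. G i * indicator (c -` {i} \<inter> space M) x)"
      using \<open>x \<in> space M\<close> by simp
  qed
  also have "\<dots> = (\<Sum>i. \<integral>\<^sup>+x. G i * indicator (c -` {i} \<inter> space M) x \<partial>M)"
    using cell by (intro nn_integral_suminf) auto
  also have "\<dots> = (\<Sum>i. G i * emeasure M (c -` {i} \<inter> space M))"
    using cell by (simp add: nn_integral_cmult_indicator)
  finally show ?thesis .
qed

lemma integral_lumped_cells:
  fixes \<gamma> :: "nat \<Rightarrow> real"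
  assumes "prob_space M" and c[measurable]: "c \<in> measurable M (count_space UNIV)"
  shows "(LINT x|M. \<gamma> (min (c x) n)) = (\<Sum>i\<le>n. \<gamma> i * lump n (\<lambda>k. measure M (c -` {k} \<inter> space M)) i)"
proof -
  interpret prob_space M by fact
  define B where "B i = (\<lambda>x. min (c x) n) -` {i} \<inter> space M" for i
  have B: "B i \<in> sets M" for i
    unfolding B_def
    by (rule measurable_sets[OF measurable_compose[OF c, of "\<lambda>k. min k n" "count_space UNIV"]]) auto
  have cell: "c -` {i} \<inter> space M \<in> sets M" for i
    by (rule measurable_sets[OF c]) auto
  have "(LINT x|M. \<gamma> (min (c x) n)) = (LINT x|M. (\<Sum>i\<le>n. \<gamma> i * indicator (B i) x))"
  proof (rule Bochner_Integration.integral_cong[OF refl])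
    fix x assume "x \<in> space M"
    then have "(\<Sum>i\<le>n. \<gamma> i * indicator (B i) x) = (\<Sum>i\<le>n. if i = min (c x) n then \<gamma> i else 0)"
      by (intro sum.cong) (auto simp: B_def split: split_indicator)
    then show "\<gamma> (min (c x) n) = (\<Sum>i\<le>n. \<gamma> i * indicator (B i) x)" by simp
  qed
  also have "\<dots> = (\<Sum>i\<le>n. \<gamma> i * measure M (B i))"
    using B by (subst Bochner_Integration.integral_sum) (auto simp: emeasure_eq_measure Int_absorb2 sets.sets_into_space)
  also have "\<dots> = (\<Sum>i\<le>n. \<gamma> i * lump n (\<lambda>k. measure M (c -` {k} \<inter> space M)) i)"
  proof (rule sum.cong[OF refl])
    fix i assume i: "i \<in> {..n}"
    have "measure M (B i) = lump n (\<lambda>k. measure M (c -` {k} \<inter> space M)) i"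
    proof (cases "i < n")
      case True
      then have "B i = c -` {i} \<inter> space M" by (auto simp: B_def min_def split: if_splits)
      then show ?thesis using True by (simp add: lump_def)
    next
      case False
      then have "i = n" using i by simp
      then have "B i = space M - (\<Union>k<n. c -` {k} \<inter> space M)" by (auto simp: B_def)
      moreover have "(\<Union>k<n. c -` {k} \<inter> space M) \<in> sets M"
        using cell by (intro sets.finite_UN) auto
      ultimately have "measure M (B i) = 1 - measure M (\<Union>k<n. c -` {k} \<inter> space M)"
        by (simp only: prob_compl)
      also have "measure M (\<Union>k<n. c -` {k} \<inter> space M) = (\<Sum>k<n. measure M (c -` {k} \<inter> space M))"
        using cell by (intro finite_measure_finite_Union) (auto simp: disjoint_family_on_def)
      finally show ?thesis using False by (simp add: lump_def)
    qed
    then show "\<gamma> i * measure M (B i) = \<gamma> i * lump n (\<lambda>k. measure M (c -` {k} \<inter> space M)) i" by simp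
  qed
  finally show ?thesis .
qed

lemma cell_probabilities_sum:
  assumes "prob_space M" and c: "c \<in> measurable M (count_space UNIV)"
  shows "(\<lambda>k::nat. measure M (c -` {k} \<inter> space M)) sums 1"
proof -
  interpret prob_space M by fact
  have "(\<lambda>k. measure M (c -` {k} \<inter> space M)) sums measure M (\<Union>k. c -` {k} \<inter> space M)"
    using measurable_sets[OF c] by (intro finite_measure_UNION) (auto simp: disjoint_family_on_def)
  moreover have "(\<Union>k. c -` {k} \<inter> space M) = space M" by auto
  ultimately show ?thesis by (simp add: prob_space)
qed

text \<open>
  Square partial sums suffice, as \<open>countable_transport_duality\<close> bounds only those.
\<close>

lemma double_suminf_le:
  fixes a :: "nat \<Rightarrow> nat \<Rightarrow> ennreal"
  assumes "\<And>n. (\<Sum>i<n. \<Sum>j<n. a i j) \<le> B"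
  shows "(\<Sum>i. \<Sum>j. a i j) \<le> B"
  unfolding suminf_eq_SUP[of "\<lambda>i. \<Sum>j. a i j"]
proof (rule SUP_least)
  fix m
  have "(\<Sum>i<m. \<Sum>j. a i j) = (\<Sum>j. \<Sum>i<m. a i j)"
    by (rule suminf_sum[symmetric]) auto
  also have "\<dots> \<le> B"
    unfolding suminf_eq_SUP
  proof (rule SUP_least)
    fix n
    have "(\<Sum>j<n. \<Sum>i<m. a i j) = (\<Sum>i<m. \<Sum>j<n. a i j)" by (rule sum.swap)
    also have "\<dots> \<le> (\<Sum>i<max m n. \<Sum>j<n. a i j)" by (intro sum_mono2) auto
    also have "\<dots> \<le> (\<Sum>i<max m n. \<Sum>j<max m n. a i j)" by (intro sum_mono sum_mono2) auto
    finally show "(\<Sum>j<n. \<Sum>i<m. a i j) \<le> B" using assms order_trans by blast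
  qed
  finally show "(\<Sum>i<m. \<Sum>j. a i j) \<le> B" .
qed

section \<open>Couplings that are constant on pairs of cells\<close>

lemma AE_cell_nonnull:
  assumes "finite_measure M" and c: "c \<in> measurable M (count_space UNIV)"
  shows "AE x in M. measure M (c -` {c x :: nat} \<inter> space M) \<noteq> 0"
proof -
  interpret finite_measure M by fact
  have "AE x in M. x \<notin> (\<Union>i\<in>{i. measure M (c -` {i} \<inter> space M) = 0}. c -` {i} \<inter> space M)"
    using measurable_sets[OF c]
    by (intro AE_not_in null_sets_UN') (auto simp: null_sets_def emeasure_eq_measure)
  then show ?thesis by (rule AE_mp) (auto intro!: AE_I2)
qed

text \<open>
  On the product of the cells \<open>i\<close> and \<open>j\<close> the coupling has the constant density \<open>w i j / (p i q j)\<close>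
  with respect to \<open>\<mu> \<otimes> \<nu>\<close>, where \<open>p\<close> and \<open>q\<close> are the cell masses under \<open>\<mu>\<close> and \<open>\<nu>\<close>; where one of
  these masses vanishes, \<open>w i j\<close> does too. Absolute continuity with respect to \<open>\<mu> \<otimes> \<nu>\<close> matters for
  the cost, which is estimated up to product null sets only.
\<close>

lemma cellwise_coupling:
  fixes \<mu> \<nu> :: "'a::metric_space measure" and w :: "nat \<Rightarrow> nat \<Rightarrow> real"
  assumes \<mu>: "borel_prob \<mu>" and \<nu>: "borel_prob \<nu>"
    and c: "c \<in> measurable borel (count_space UNIV)"
    and w: "\<And>i j. 0 \<le> w i j"
    and row: "\<And>i. (\<lambda>j. w i j) sums measure \<mu> (c -` {i})"
    and col: "\<And>j. (\<lambda>i. w i j) sums measure \<nu> (c -` {j})"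
  obtains \<pi> where "\<pi> \<in> couplings \<mu> \<nu>" and "absolutely_continuous (\<mu> \<Otimes>\<^sub>M \<nu>) \<pi>"
    and "\<And>F. (\<integral>\<^sup>+p. F (c (fst p)) (c (snd p)) \<partial>\<pi>) = (\<Sum>i. \<Sum>j. F i j * ennreal (w i j))"
proof -
  define r where "r i j = w i j / (measure \<mu> (c -` {i}) * measure \<nu> (c -` {j}))" for i j
  define \<pi> where "\<pi> = density (\<mu> \<Otimes>\<^sub>M \<nu>) (\<lambda>(x, y). ennreal (r (c x) (c y)))"
  interpret \<mu>: prob_space \<mu> using \<mu> by (simp add: borel_prob_def)
  interpret \<nu>: prob_space \<nu> using \<nu> by (simp add: borel_prob_def)
  interpret P: pair_prob_space \<mu> \<nu> ..
  have sets\<mu>: "sets \<mu> = sets borel" and sets\<nu>: "sets \<nu> = sets borel"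
    using \<mu> \<nu> by (simp_all add: borel_prob_def)
  have [simp]: "space \<mu> = UNIV" "space \<nu> = UNIV"
    using sets_eq_imp_space_eq[OF sets\<mu>] sets_eq_imp_space_eq[OF sets\<nu>] by auto
  have [measurable]: "c \<in> measurable \<mu> (count_space UNIV)" "c \<in> measurable \<nu> (count_space UNIV)"
    using c by (simp_all add: measurable_cong_sets[OF sets\<mu> refl] measurable_cong_sets[OF sets\<nu> refl])
  define p where "p i = measure \<mu> (c -` {i})" for i
  define q where "q j = measure \<nu> (c -` {j})" for j
  have p0: "0 \<le> p i" and q0: "0 \<le> q i" for i by (simp_all add: p_def q_def)
  have w_le: "w i j \<le> p i" "w i j \<le> q j" for i j
    using sum_le_suminf[of "\<lambda>j. w i j" "{j}"] sum_le_suminf[of "\<lambda>i. w i j" "{i}"] row[of i] col[of j] w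
    by (auto simp: p_def q_def sums_iff)
  have w_zero: "w i j = 0" if "p i = 0 \<or> q j = 0" for i j
    using w_le[of i j] w[of i j] that by auto
  have r: "r i j = w i j / (p i * q j)" for i j by (simp add: r_def p_def q_def)
  have r0: "0 \<le> r i j" for i j using w p0 q0 by (simp add: r)
  have rpq: "r i j * p i * q j = w i j" for i j
    using w_zero[of i j] by (auto simp: r)
  have int_\<mu>: "(\<integral>\<^sup>+x. G (c x) \<partial>\<mu>) = (\<Sum>i. G i * ennreal (p i))" for G
    by (subst nn_integral_cells) (auto simp: p_def \<mu>.emeasure_eq_measure)
  have int_\<nu>: "(\<integral>\<^sup>+x. G (c x) \<partial>\<nu>) = (\<Sum>i. G i * ennreal (q i))" for G
    by (subst nn_integral_cells) (auto simp: q_def \<nu>.emeasure_eq_measure)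
  have dens: "(\<lambda>(x, y). ennreal (r (c x) (c y))) \<in> borel_measurable (\<mu> \<Otimes>\<^sub>M \<nu>)"
    by measurable
  have row1: "(\<integral>\<^sup>+y. ennreal (r (c x) (c y)) \<partial>\<nu>) = 1" if "p (c x) \<noteq> 0" for x
  proof -
    have "r (c x) j * q j = w (c x) j / p (c x)" for j
      using rpq[of "c x" j] that by (simp add: field_simps)
    moreover have "(\<lambda>j. w (c x) j / p (c x)) sums 1"
      using sums_divide[OF row[of "c x"], of "p (c x)"] that by (simp add: p_def)
    ultimately have "(\<Sum>j. ennreal (r (c x) j * q j)) = 1"
      using r0 q0 by (intro sums_unique[symmetric]) (simp add: sums_ennreal w p0 q0 flip: ennreal_1)
    then show ?thesis
      unfolding int_\<nu>[of "\<lambda>j. ennreal (r (c x) j)"] using r0 q0 by (simp add: ennreal_mult)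
  qed
  have col1: "(\<integral>\<^sup>+x. ennreal (r (c x) (c y)) \<partial>\<mu>) = 1" if "q (c y) \<noteq> 0" for y
  proof -
    have "r i (c y) * p i = w i (c y) / q (c y)" for i
      using rpq[of i "c y"] that by (simp add: field_simps)
    moreover have "(\<lambda>i. w i (c y) / q (c y)) sums 1"
      using sums_divide[OF col[of "c y"], of "q (c y)"] that by (simp add: q_def)
    ultimately have "(\<Sum>i. ennreal (r i (c y) * p i)) = 1"
      using r0 p0 by (intro sums_unique[symmetric]) (simp add: sums_ennreal w p0 q0 flip: ennreal_1)
    then show ?thesis
      unfolding int_\<mu>[of "\<lambda>i. ennreal (r i (c y))"] using r0 p0 by (simp add: ennreal_mult)
  qed
  have ae_p: "AE x in \<mu>. p (c x) \<noteq> 0"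
    using AE_cell_nonnull[OF \<mu>.finite_measure_axioms, of c] by (simp add: p_def)
  have ae_q: "AE x in \<nu>. q (c x) \<noteq> 0"
    using AE_cell_nonnull[OF \<nu>.finite_measure_axioms, of c] by (simp add: q_def)
  have sets\<pi>: "sets \<pi> = sets (\<mu> \<Otimes>\<^sub>M \<nu>)" by (simp add: \<pi>_def)
  have fst\<pi>: "distr \<pi> borel fst = \<mu>"
  proof (rule measure_eqI)
    fix A assume "A \<in> sets (distr \<pi> borel fst)"
    then have A[measurable]: "A \<in> sets \<mu>" "A \<in> sets borel" using sets\<mu> by auto
    have [measurable]: "fst \<in> measurable \<pi> borel"
      unfolding measurable_cong_sets[OF sets\<pi> sets\<mu>[symmetric]] by measurable
    have "emeasure (distr \<pi> borel fst) A = (\<integral>\<^sup>+z. indicator A (fst z) \<partial>\<pi>)"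
      by (subst nn_integral_indicator[symmetric], simp, subst nn_integral_distr) auto
    also have "\<dots> = (\<integral>\<^sup>+z. (case z of (x, y) \<Rightarrow> ennreal (r (c x) (c y))) * indicator A (fst z) \<partial>(\<mu> \<Otimes>\<^sub>M \<nu>))"
      unfolding \<pi>_def by (rule nn_integral_density[OF dens]) measurable
    also have "\<dots> = (\<integral>\<^sup>+x. \<integral>\<^sup>+y. ennreal (r (c x) (c y)) * indicator A x \<partial>\<nu> \<partial>\<mu>)"
      by (subst \<nu>.nn_integral_fst[symmetric]) auto
    also have "\<dots> = (\<integral>\<^sup>+x. indicator A x \<partial>\<mu>)"
    proof (rule nn_integral_cong_AE)
      show "AE x in \<mu>. (\<integral>\<^sup>+y. ennreal (r (c x) (c y)) * indicator A x \<partial>\<nu>) = indicator A x"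
        using ae_p by eventually_elim (subst nn_integral_multc, auto simp: row1)
    qed
    finally show "emeasure (distr \<pi> borel fst) A = emeasure \<mu> A" by simp
  qed (simp add: sets\<mu>)
  have snd\<pi>: "distr \<pi> borel snd = \<nu>"
  proof (rule measure_eqI)
    fix A assume "A \<in> sets (distr \<pi> borel snd)"
    then have A[measurable]: "A \<in> sets \<nu>" "A \<in> sets borel" using sets\<nu> by auto
    have [measurable]: "snd \<in> measurable \<pi> borel"
      unfolding measurable_cong_sets[OF sets\<pi> sets\<nu>[symmetric]] by measurable
    have "emeasure (distr \<pi> borel snd) A = (\<integral>\<^sup>+z. indicator A (snd z) \<partial>\<pi>)"
      by (subst nn_integral_indicator[symmetric], simp, subst nn_integral_distr) auto
    also have "\<dots> = (\<integral>\<^sup>+z. (case z of (x, y) \<Rightarrow> ennreal (r (c x) (c y))) * indicator A (snd z) \<partial>(\<mu> \<Otimes>\<^sub>M \<nu>))"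
      unfolding \<pi>_def by (rule nn_integral_density[OF dens]) measurable
    also have "\<dots> = (\<integral>\<^sup>+y. \<integral>\<^sup>+x. ennreal (r (c x) (c y)) * indicator A y \<partial>\<mu> \<partial>\<nu>)"
      by (subst P.nn_integral_snd[symmetric]) auto
    also have "\<dots> = (\<integral>\<^sup>+y. indicator A y \<partial>\<nu>)"
    proof (rule nn_integral_cong_AE)
      show "AE y in \<nu>. (\<integral>\<^sup>+x. ennreal (r (c x) (c y)) * indicator A y \<partial>\<mu>) = indicator A y"
        using ae_q by eventually_elim (subst nn_integral_multc, auto simp: col1)
    qed
    finally show "emeasure (distr \<pi> borel snd) A = emeasure \<nu> A" by simp
  qed (simp add: sets\<nu>)
  have "prob_space \<pi>"
  proof
    have [measurable]: "fst \<in> measurable \<pi> borel"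
      unfolding measurable_cong_sets[OF sets\<pi> sets\<mu>[symmetric]] by measurable
    have "emeasure \<pi> (space \<pi>) = emeasure (distr \<pi> borel fst) UNIV"
      by (subst emeasure_distr) auto
    also have "\<dots> = 1" unfolding fst\<pi> using \<mu>.emeasure_space_1 by simp
    finally show "emeasure \<pi> (space \<pi>) = 1" .
  qed
  then have "\<pi> \<in> couplings \<mu> \<nu>"
    using fst\<pi> snd\<pi> sets\<pi> sets_pair_measure_cong[OF sets\<mu> sets\<nu>] by (simp add: couplings_def)
  moreover have "absolutely_continuous (\<mu> \<Otimes>\<^sub>M \<nu>) \<pi>"
    unfolding \<pi>_def by (rule absolutely_continuousI_density[OF dens])
  moreover have "(\<integral>\<^sup>+p. F (c (fst p)) (c (snd p)) \<partial>\<pi>) = (\<Sum>i. \<Sum>j. F i j * ennreal (w i j))"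
    for F :: "nat \<Rightarrow> nat \<Rightarrow> ennreal"
  proof -
    have "(\<integral>\<^sup>+z. F (c (fst z)) (c (snd z)) \<partial>\<pi>)
        = (\<integral>\<^sup>+z. (case z of (x, y) \<Rightarrow> ennreal (r (c x) (c y))) * F (c (fst z)) (c (snd z)) \<partial>(\<mu> \<Otimes>\<^sub>M \<nu>))"
      unfolding \<pi>_def by (rule nn_integral_density[OF dens]) measurable
    also have "\<dots> = (\<integral>\<^sup>+x. \<integral>\<^sup>+y. ennreal (r (c x) (c y)) * F (c x) (c y) \<partial>\<nu> \<partial>\<mu>)"
      by (subst \<nu>.nn_integral_fst[symmetric]) auto
    also have "\<dots> = (\<integral>\<^sup>+x. (\<Sum>j. ennreal (r (c x) j) * F (c x) j * ennreal (q j)) \<partial>\<mu>)"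
      by (intro nn_integral_cong int_\<nu>)
    also have "\<dots> = (\<Sum>i. (\<Sum>j. ennreal (r i j) * F i j * ennreal (q j)) * ennreal (p i))"
      by (rule int_\<mu>)
    also have "\<dots> = (\<Sum>i. \<Sum>j. F i j * ennreal (w i j))"
    proof (intro suminf_cong)
      fix i
      have "(\<Sum>j. ennreal (r i j) * F i j * ennreal (q j)) * ennreal (p i)
          = (\<Sum>j. ennreal (r i j) * F i j * ennreal (q j) * ennreal (p i))"
        by (rule ennreal_suminf_multc[symmetric])
      also have "\<dots> = (\<Sum>j. F i j * ennreal (w i j))"
      proof (intro suminf_cong)
        fix j
        have "ennreal (w i j) = ennreal (r i j) * ennreal (p i) * ennreal (q j)"
          using r0 p0 q0 by (simp flip: ennreal_mult rpq)
        then show "ennreal (r i j) * F i j * ennreal (q j) * ennreal (p i) = F i j * ennreal (w i j)"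
          by (simp add: ac_simps)
      qed
      finally show "(\<Sum>j. ennreal (r i j) * F i j * ennreal (q j)) * ennreal (p i)
          = (\<Sum>j. F i j * ennreal (w i j))" .
    qed
    finally show ?thesis .
  qed
  ultimately show ?thesis by (rule that)
qed

text \<open>
  The squared distance need not be product-measurable, so the left-hand side is a lower integral.
  Where a measurable minorant of \<open>d\<^sup>2\<close> exceeded \<open>(D i j + 2 \<epsilon>)\<^sup>2\<close> on a non-null part of the cell
  \<open>(i, j)\<close>, \<open>block_rectangle\<close> would make the essential distance of the two cells larger than
  \<open>D i j\<close>.
\<close>

lemma lower_cost_le_cell_cost:
  fixes \<mu> \<nu> :: "'a::metric_space measure"
  assumes \<mu>: "borel_prob \<mu>" and \<nu>: "borel_prob \<nu>" and ac: "absolutely_continuous \<nu> \<mu>"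
    and N: "N \<in> null_sets \<nu>"
    and block: "\<And>n::nat. block \<nu> \<epsilon> (c -` {n} - N)" and "0 \<le> \<epsilon>"
    and \<pi>: "sets \<pi> = sets (borel \<Otimes>\<^sub>M borel)" "absolutely_continuous (\<mu> \<Otimes>\<^sub>M \<nu>) \<pi>"
  defines "D \<equiv> \<lambda>i j. ess_dist \<nu> (c -` {i} - N) (c -` {j} - N)"
  shows "(\<integral>\<^sup>+p. ennreal ((dist (fst p) (snd p))\<^sup>2) \<partial>\<pi>)
    \<le> (\<integral>\<^sup>+p. ennreal ((D (c (fst p)) (c (snd p)) + 2 * \<epsilon>)\<^sup>2) \<partial>\<pi>)"
    (is "?lower \<le> ?upper")
proof -
  interpret \<mu>: prob_space \<mu> using \<mu> by (simp add: borel_prob_def)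
  interpret \<nu>: prob_space \<nu> using \<nu> by (simp add: borel_prob_def)
  have sets\<mu>: "sets \<mu> = sets borel" and sets\<nu>: "sets \<nu> = sets borel"
    using \<mu> \<nu> by (simp_all add: borel_prob_def)
  have space: "space \<mu> = UNIV" "space \<nu> = UNIV"
    using sets_eq_imp_space_eq[OF sets\<mu>] sets_eq_imp_space_eq[OF sets\<nu>] by auto
  have setsP: "sets (\<mu> \<Otimes>\<^sub>M \<nu>) = sets (borel \<Otimes>\<^sub>M borel)"
    by (rule sets_pair_measure_cong[OF sets\<mu> sets\<nu>])
  define A where "A i = c -` {i} - N" for i
  have A: "A i \<in> sets \<nu>" for i using block[of i] by (auto simp: block_def A_def)
  have D0: "0 \<le> D i j" for i j
    unfolding D_def using ess_dist_nonneg[OF sets\<nu>] A by (simp add: A_def)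
  have strip: "(M \<times> UNIV) \<union> (UNIV \<times> M) \<in> null_sets (\<mu> \<Otimes>\<^sub>M \<nu>)" if M: "M \<in> null_sets \<nu>" for M
  proof (rule null_sets.Un)
    have M\<mu>: "M \<in> null_sets \<mu>" using ac M by (auto simp: absolutely_continuous_def)
    have "emeasure (\<mu> \<Otimes>\<^sub>M \<nu>) (M \<times> space \<nu>) = emeasure \<mu> M * emeasure \<nu> (space \<nu>)"
      using M\<mu> by (intro \<nu>.emeasure_pair_measure_Times) auto
    then have "M \<times> space \<nu> \<in> null_sets (\<mu> \<Otimes>\<^sub>M \<nu>)"
      using M\<mu> by (intro null_setsI pair_measureI) auto
    then show "M \<times> UNIV \<in> null_sets (\<mu> \<Otimes>\<^sub>M \<nu>)" by (simp add: space)
    have "emeasure (\<mu> \<Otimes>\<^sub>M \<nu>) (space \<mu> \<times> M) = emeasure \<mu> (space \<mu>) * emeasure \<nu> M"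
      using M by (intro \<nu>.emeasure_pair_measure_Times) auto
    then have "space \<mu> \<times> M \<in> null_sets (\<mu> \<Otimes>\<^sub>M \<nu>)"
      using M by (intro null_setsI pair_measureI) auto
    then show "UNIV \<times> M \<in> null_sets (\<mu> \<Otimes>\<^sub>M \<nu>)" by (simp add: space)
  qed
  have simple_le: "integral\<^sup>N \<pi> g \<le> ?upper"
    if g: "g \<in> borel_measurable \<pi>" "\<And>p. g p \<le> ennreal ((dist (fst p) (snd p))\<^sup>2)" for g
  proof (rule nn_integral_mono_AE)
    have [measurable]: "g \<in> borel_measurable (borel \<Otimes>\<^sub>M borel)"
      using g(1) by (simp add: measurable_cong_sets[OF \<pi>(1) refl])
    define S where "S i j n = {p. g p \<ge> ennreal ((D i j + 2 * \<epsilon> + 1 / Suc n)\<^sup>2)} \<inter> A i \<times> A j" for i j n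
    have S_sets: "S i j n \<in> sets (borel \<Otimes>\<^sub>M borel)" for i j n
    proof -
      have "{p \<in> space (borel \<Otimes>\<^sub>M borel). g p \<ge> ennreal ((D i j + 2 * \<epsilon> + 1 / Suc n)\<^sup>2)}
          \<in> sets (borel \<Otimes>\<^sub>M borel)" by measurable
      moreover have "A i \<times> A j \<in> sets (borel \<Otimes>\<^sub>M borel)"
        using A sets\<nu> by (intro pair_measureI) auto
      ultimately show ?thesis unfolding S_def by (auto simp: space_pair_measure)
    qed
    have S_null: "S i j n \<in> null_sets (\<mu> \<Otimes>\<^sub>M \<nu>)" for i j n
    proof (rule ccontr)
      assume nn: "S i j n \<notin> null_sets (\<mu> \<Otimes>\<^sub>M \<nu>)"
      define s where "s = D i j + 2 * \<epsilon> + 1 / Suc n"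
      have s0: "0 \<le> s" using D0 \<open>0 \<le> \<epsilon>\<close> by (simp add: s_def)
      have meets: "\<exists>(x, y)\<in>S i j n. x \<notin> M \<and> y \<notin> M" if "M \<in> null_sets \<nu>" for M
      proof (rule ccontr)
        assume "\<not> (\<exists>(x, y)\<in>S i j n. x \<notin> M \<and> y \<notin> M)"
        then have "S i j n \<subseteq> (M \<times> UNIV) \<union> (UNIV \<times> M)" by fastforce
        then show False
          using nn null_sets_subset[OF strip[OF that]] S_sets setsP by blast
      qed
      have far: "s \<le> dist x y" if "(x, y) \<in> S i j n" for x y
      proof -
        have "ennreal (s\<^sup>2) \<le> g (x, y)"
          using that by (simp add: S_def s_def)
        also have "\<dots> \<le> ennreal ((dist x y)\<^sup>2)"
          using g(2)[of "(x, y)"] by simp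
        finally have "ennreal (s\<^sup>2) \<le> ennreal ((dist x y)\<^sup>2)" .
        then have "s\<^sup>2 \<le> (dist x y)\<^sup>2" by (simp add: ennreal_le_iff)
        then show ?thesis by (rule power2_le_imp_le) simp
      qed
      obtain M where M: "M \<in> null_sets \<nu>" "\<And>x y. x \<in> A i - M \<Longrightarrow> y \<in> A j - M \<Longrightarrow> s - 2 * \<epsilon> \<le> dist x y"
        using block_rectangle[OF sets\<nu> block[of i] block[of j] S_sets _ far meets]
        unfolding A_def S_def by blast
      have "A i \<notin> null_sets \<nu>" "A j \<notin> null_sets \<nu>"
        using meets[of "A i"] meets[of "A j"] by (auto simp: S_def)
      then have "s - 2 * \<epsilon> \<le> D i j"
        unfolding D_def A_def[symmetric] using A M by (intro ess_dist_greatest[OF sets\<nu>]) auto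
      moreover have "0 < 1 / real (Suc n)" by simp
      ultimately show False by (simp add: s_def)
    qed
    have "(\<Union>i. \<Union>j. \<Union>n. S i j n) \<in> null_sets (\<mu> \<Otimes>\<^sub>M \<nu>)"
      by (intro null_sets_UN S_null)
    then have "(\<Union>i. \<Union>j. \<Union>n. S i j n) \<in> null_sets \<pi>" "(N \<times> UNIV) \<union> (UNIV \<times> N) \<in> null_sets \<pi>"
      using \<pi>(2) strip[OF N] by (auto simp: absolutely_continuous_def)
    from this[THEN AE_not_in]
    show "AE p in \<pi>. g p \<le> ennreal ((D (c (fst p)) (c (snd p)) + 2 * \<epsilon>)\<^sup>2)"
    proof eventually_elim
      case (elim p)
      define E where "E = D (c (fst p)) (c (snd p)) + 2 * \<epsilon>"
      have le: "g p \<le> ennreal ((E + 1 / Suc n)\<^sup>2)" for n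
      proof -
        have "p \<notin> S (c (fst p)) (c (snd p)) n" using elim(1) by blast
        moreover have "p \<in> A (c (fst p)) \<times> A (c (snd p))"
          using elim(2) by (cases p) (auto simp: A_def)
        ultimately show ?thesis by (auto simp: S_def E_def)
      qed
      have lim: "(\<lambda>n. ennreal ((E + 1 / Suc n)\<^sup>2)) \<longlonglongrightarrow> ennreal ((E + 0)\<^sup>2)"
        using LIMSEQ_inverse_real_of_nat
        by (intro tendsto_ennrealI tendsto_intros) (simp add: inverse_eq_divide)
      have "g p \<le> ennreal ((E + 0)\<^sup>2)"
        using LIMSEQ_le_const[OF lim] le by blast
      then show ?case by (simp add: E_def)
    qed
  qed
  show ?thesis
    unfolding nn_integral_def[of \<pi> "\<lambda>p. ennreal ((dist (fst p) (snd p))\<^sup>2)"]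
  proof (rule SUP_least)
    fix g assume "g \<in> {g. simple_function \<pi> g \<and> g \<le> (\<lambda>p. ennreal ((dist (fst p) (snd p))\<^sup>2))}"
    then have g: "simple_function \<pi> g" "\<And>p. g p \<le> ennreal ((dist (fst p) (snd p))\<^sup>2)"
      by (auto simp: le_fun_def)
    have "integral\<^sup>S \<pi> g = integral\<^sup>N \<pi> g"
      by (rule nn_integral_eq_simple_integral[OF g(1), symmetric])
    also have "\<dots> \<le> ?upper"
      using g by (intro simple_le borel_measurable_simple_function)
    finally show "integral\<^sup>S \<pi> g \<le> ?upper" .
  qed
qed

text \<open>
  The error is absorbed by \<open>(D + 2 \<epsilon>)\<^sup>2 \<le> (1 + \<epsilon>) D\<^sup>2 + 4 \<epsilon>\<^sup>2 + 4 \<epsilon>\<close>: the part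
  proportional to \<open>D\<^sup>2\<close> sums to at most \<open>(1 + \<epsilon>) V\<close>, the rest is weighted by a total mass of at
  most \<open>1\<close>.
\<close>

lemma transport_cost_le_of_plan:
  fixes \<mu> \<nu> :: "'a::metric_space measure"
  assumes \<mu>: "borel_prob \<mu>" and \<nu>: "borel_prob \<nu>" and ac: "absolutely_continuous \<nu> \<mu>"
    and c: "c \<in> measurable borel (count_space UNIV)" and N: "N \<in> null_sets \<nu>"
    and block: "\<And>n::nat. block \<nu> \<epsilon> (c -` {n} - N)" and \<epsilon>: "0 < \<epsilon>"
    and w: "\<And>i j. 0 \<le> w i j"
    and row: "\<And>i. (\<lambda>j. w i j) sums measure \<mu> (c -` {i})"
    and col: "\<And>j. (\<lambda>i. w i j) sums measure \<nu> (c -` {j})"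
    and cost: "\<And>n. (\<Sum>i<n. \<Sum>j<n. (ess_dist \<nu> (c -` {i} - N) (c -` {j} - N))\<^sup>2 * w i j) \<le> V"
  shows "transport_cost \<mu> \<nu> \<le> ennreal ((1 + \<epsilon>) * V + 4 * \<epsilon>\<^sup>2 + 4 * \<epsilon>)"
proof -
  interpret \<mu>: prob_space \<mu> using \<mu> by (simp add: borel_prob_def)
  have sets\<mu>: "sets \<mu> = sets borel" using \<mu> by (simp add: borel_prob_def)
  define D where "D i j = ess_dist \<nu> (c -` {i} - N) (c -` {j} - N)" for i j
  define p where "p i = measure \<mu> (c -` {i})" for i
  obtain \<pi> where \<pi>: "\<pi> \<in> couplings \<mu> \<nu>" "absolutely_continuous (\<mu> \<Otimes>\<^sub>M \<nu>) \<pi>"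
    and int: "\<And>F. (\<integral>\<^sup>+p. F (c (fst p)) (c (snd p)) \<partial>\<pi>) = (\<Sum>i. \<Sum>j. F i j * ennreal (w i j))"
    by (rule cellwise_coupling[OF \<mu> \<nu> c w row col]) blast
  have sq: "(D i j + 2 * \<epsilon>)\<^sup>2 \<le> (1 + \<epsilon>) * (D i j)\<^sup>2 + (4 * \<epsilon>\<^sup>2 + 4 * \<epsilon>)" for i j
  proof -
    \<comment> \<open>the difference of the two sides\<close>
    have "0 \<le> \<epsilon> * (D i j - 2)\<^sup>2" using \<epsilon> by simp
    then show ?thesis by (simp add: power2_eq_square algebra_simps)
  qed
  have mass: "(\<Sum>i<n. \<Sum>j<n. w i j) \<le> 1" for n
  proof -
    have "(\<Sum>i<n. \<Sum>j<n. w i j) \<le> (\<Sum>i<n. p i)"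
      using sum_le_suminf[of "\<lambda>j. w _ j" "{..<n}"] row w
      by (intro sum_mono) (auto simp: p_def sums_iff)
    also have "\<dots> = measure \<mu> (\<Union>i<n. c -` {i})"
      unfolding p_def using measurable_sets[OF c] sets\<mu>
      by (intro \<mu>.finite_measure_finite_Union[symmetric]) (auto simp: disjoint_family_on_def)
    also have "\<dots> \<le> 1" by (rule \<mu>.prob_le_1)
    finally show ?thesis .
  qed
  have "transport_cost \<mu> \<nu> \<le> (\<integral>\<^sup>+p. ennreal ((dist (fst p) (snd p))\<^sup>2) \<partial>\<pi>)"
    unfolding transport_cost_def using \<pi>(1) by (rule INF_lower)
  also have "\<dots> \<le> (\<integral>\<^sup>+p. ennreal ((D (c (fst p)) (c (snd p)) + 2 * \<epsilon>)\<^sup>2) \<partial>\<pi>)"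
    unfolding D_def using \<pi> \<epsilon>
    by (intro lower_cost_le_cell_cost[OF \<mu> \<nu> ac N block]) (auto simp: couplings_def)
  also have "\<dots> = (\<Sum>i. \<Sum>j. ennreal ((D i j + 2 * \<epsilon>)\<^sup>2) * ennreal (w i j))"
    by (rule int)
  also have "\<dots> \<le> ennreal ((1 + \<epsilon>) * V + 4 * \<epsilon>\<^sup>2 + 4 * \<epsilon>)"
  proof (rule double_suminf_le)
    fix n
    have "(\<Sum>i<n. \<Sum>j<n. (D i j + 2 * \<epsilon>)\<^sup>2 * w i j)
        \<le> (\<Sum>i<n. \<Sum>j<n. ((1 + \<epsilon>) * (D i j)\<^sup>2 + (4 * \<epsilon>\<^sup>2 + 4 * \<epsilon>)) * w i j)"
      using sq w by (intro sum_mono mult_right_mono) auto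
    also have "\<dots> = (1 + \<epsilon>) * (\<Sum>i<n. \<Sum>j<n. (D i j)\<^sup>2 * w i j)
        + (4 * \<epsilon>\<^sup>2 + 4 * \<epsilon>) * (\<Sum>i<n. \<Sum>j<n. w i j)"
      by (simp add: sum_distrib_left sum.distrib distrib_right mult.assoc)
    also have "\<dots> \<le> (1 + \<epsilon>) * V + (4 * \<epsilon>\<^sup>2 + 4 * \<epsilon>) * 1"
      using cost[of n] mass[of n] \<epsilon> by (intro add_mono mult_left_mono) (auto simp: D_def)
    finally have le: "(\<Sum>i<n. \<Sum>j<n. (D i j + 2 * \<epsilon>)\<^sup>2 * w i j) \<le> (1 + \<epsilon>) * V + 4 * \<epsilon>\<^sup>2 + 4 * \<epsilon>"
      by simp
    have "(\<Sum>i<n. \<Sum>j<n. ennreal ((D i j + 2 * \<epsilon>)\<^sup>2) * ennreal (w i j))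
        = ennreal (\<Sum>i<n. \<Sum>j<n. (D i j + 2 * \<epsilon>)\<^sup>2 * w i j)"
      using w by (simp add: sum_nonneg sum_ennreal flip: ennreal_mult)
    also have "\<dots> \<le> ennreal ((1 + \<epsilon>) * V + 4 * \<epsilon>\<^sup>2 + 4 * \<epsilon>)"
      using le by (rule ennreal_leI)
    finally show "(\<Sum>i<n. \<Sum>j<n. ennreal ((D i j + 2 * \<epsilon>)\<^sup>2) * ennreal (w i j))
        \<le> ennreal ((1 + \<epsilon>) * V + 4 * \<epsilon>\<^sup>2 + 4 * \<epsilon>)" .
  qed
  finally show ?thesis .
qed

section \<open>The transportation inequality\<close>

text \<open>
  A feasible pair of discrete potentials is spread out over the cells. Feasibility holds only
  off the null set \<open>N\<close>; there the potentials are replaced by the extreme values \<open>- L\<close> and \<open>L\<close>,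
  which makes their difference nonpositive wherever one of the points is in \<open>N\<close>. The
  factor \<open>2\<close> comes from the cost \<open>d\<^sup>2\<close> in place of \<open>d\<^sup>2 / 2\<close>.
\<close>

lemma cell_potentials_le_entropy:
  fixes \<nu> :: "'a::metric_space measure" and \<rho> :: "'a \<Rightarrow> real"
  assumes \<nu>: "borel_prob \<nu>" and PL: "PL K \<nu>" and K: "0 < K"
    and \<rho>: "\<rho> \<in> borel_measurable borel" "\<And>x. 0 \<le> \<rho> x"
    and \<mu>: "prob_space (density \<nu> \<rho>)"
    and ent: "integrable \<nu> (\<lambda>x. \<rho> x * ln (\<rho> x))"
    and c: "c \<in> measurable borel (count_space UNIV)" and N: "N \<in> null_sets \<nu>"
    and d: "\<And>i j x y. x \<in> c -` {i} - N \<Longrightarrow> y \<in> c -` {j} - N \<Longrightarrow> d i j \<le> (dist x y)\<^sup>2"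
    and \<alpha>\<beta>: "\<And>i j. i \<le> n \<Longrightarrow> j \<le> n \<Longrightarrow> \<alpha> i + \<beta> j \<le> (if i < n \<and> j < n then d i j else 0)"
  shows "(\<Sum>i\<le>n. \<alpha> i * lump n (\<lambda>k. measure (density \<nu> \<rho>) (c -` {k})) i)
       + (\<Sum>j\<le>n. \<beta> j * lump n (\<lambda>k. measure \<nu> (c -` {k})) j)
       \<le> 2 / K * (LINT x|\<nu>. \<rho> x * ln (\<rho> x))"
proof -
  define \<mu>' where "\<mu>' = density \<nu> \<rho>"
  interpret \<nu>: prob_space \<nu> using \<nu> by (simp add: borel_prob_def)
  interpret \<mu>: prob_space \<mu>' using \<mu> by (simp add: \<mu>'_def)
  have sets\<nu>: "sets \<nu> = sets borel" using \<nu> by (simp add: borel_prob_def)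
  then have sets\<mu>: "sets \<mu>' = sets borel" by (simp add: \<mu>'_def)
  have space: "space \<nu> = UNIV" "space \<mu>' = UNIV"
    using sets_eq_imp_space_eq[OF sets\<mu>] sets_eq_imp_space_eq[OF sets\<nu>] by auto
  have c\<nu>: "c \<in> measurable \<nu> (count_space UNIV)" and c\<mu>: "c \<in> measurable \<mu>' (count_space UNIV)"
    using c by (simp_all add: measurable_cong_sets[OF sets\<nu> refl] measurable_cong_sets[OF sets\<mu> refl])
  have Nb: "N \<in> sets borel" using N sets\<nu> by auto
  have N\<mu>: "N \<in> null_sets \<mu>'"
  proof -
    have "absolutely_continuous \<nu> \<mu>'" unfolding \<mu>'_def
      using \<rho> by (intro absolutely_continuousI_density)
        (simp add: measurable_cong_sets[OF sets\<nu> refl])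
    then show ?thesis using N by (auto simp: absolutely_continuous_def)
  qed
  define L where "L = (\<Sum>i\<le>n. \<bar>\<alpha> i\<bar> + \<bar>\<beta> i\<bar>)"
  have L: "\<bar>\<alpha> i\<bar> \<le> L" "\<bar>\<beta> i\<bar> \<le> L" "0 \<le> L" if "i \<le> n" for i
  proof -
    have "\<bar>\<alpha> i\<bar> + \<bar>\<beta> i\<bar> \<le> L" unfolding L_def
      using that by (intro member_le_sum[of i "{..n}" "\<lambda>i. \<bar>\<alpha> i\<bar> + \<bar>\<beta> i\<bar>"]) auto
    then show "\<bar>\<alpha> i\<bar> \<le> L" "\<bar>\<beta> i\<bar> \<le> L" "0 \<le> L" by auto
  qed
  define m where "m x = min (c x) n" for x
  define g where "g x = (if x \<in> N then - L else \<alpha> (m x) / 2)" for x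
  define f where "f x = (if x \<in> N then L else - \<beta> (m x) / 2)" for x
  have m_meas: "(\<lambda>x. \<gamma> (m x)) \<in> borel_measurable borel" for \<gamma> :: "nat \<Rightarrow> real"
    unfolding m_def by (rule measurable_compose[OF c]) simp
  have g_meas: "g \<in> borel_measurable borel" and f_meas: "f \<in> borel_measurable borel"
    unfolding g_def f_def using Nb m_meas[of "\<lambda>i. \<alpha> i / 2"] m_meas[of "\<lambda>i. - \<beta> i / 2"]
    by (auto intro!: measurable_If_set)
  have g_bd: "\<bar>g x\<bar> \<le> L" and f_bd: "\<bar>f x\<bar> \<le> L" for x
    using L[of "m x"] by (auto simp: g_def f_def m_def)
  have fg: "g y - f x \<le> (dist x y)\<^sup>2 / 2" for x y
  proof (cases "x \<in> N \<or> y \<in> N")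
    case True
    have "g y \<le> L" "- L \<le> f x" using g_bd[of y] f_bd[of x] by auto
    then have "g y - f x \<le> 0" using True by (auto simp: g_def f_def)
    moreover have "0 \<le> (dist x y)\<^sup>2 / 2" by simp
    ultimately show ?thesis by linarith
  next
    case False
    have "\<alpha> (m y) + \<beta> (m x) \<le> (if m y < n \<and> m x < n then d (m y) (m x) else 0)"
      by (intro \<alpha>\<beta>) (auto simp: m_def)
    also have "\<dots> \<le> (dist y x)\<^sup>2"
      using d[of y "m y" x "m x"] False by (auto simp: m_def min_def split: if_splits)
    finally show ?thesis using False by (simp add: g_def f_def dist_commute field_simps)
  qed
  have int_g: "(LINT x|\<mu>'. g x) = (\<Sum>i\<le>n. \<alpha> i * lump n (\<lambda>k. measure \<mu>' (c -` {k})) i) / 2"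
  proof -
    have "AE x in \<mu>'. g x = \<alpha> (m x) / 2"
      using AE_not_in[OF N\<mu>] by eventually_elim (simp add: g_def)
    then have "(LINT x|\<mu>'. g x) = (LINT x|\<mu>'. \<alpha> (m x) / 2)"
      using g_meas m_meas[of "\<lambda>i. \<alpha> i / 2"]
      by (intro integral_cong_AE) (simp_all add: measurable_cong_sets[OF sets\<mu> refl])
    also have "\<dots> = (\<Sum>i\<le>n. \<alpha> i / 2 * lump n (\<lambda>k. measure \<mu>' (c -` {k})) i)"
      using integral_lumped_cells[OF \<mu>.prob_space_axioms c\<mu>, of "\<lambda>i. \<alpha> i / 2" n] by (simp add: space m_def)
    finally show ?thesis by (simp add: sum_divide_distrib)
  qed
  have int_f: "(LINT x|\<nu>. f x) = - (\<Sum>j\<le>n. \<beta> j * lump n (\<lambda>k. measure \<nu> (c -` {k})) j) / 2"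
  proof -
    have "AE x in \<nu>. f x = - \<beta> (m x) / 2"
      using AE_not_in[OF N] by eventually_elim (simp add: f_def)
    then have "(LINT x|\<nu>. f x) = (LINT x|\<nu>. - \<beta> (m x) / 2)"
      using f_meas m_meas[of "\<lambda>i. - \<beta> i / 2"]
      by (intro integral_cong_AE) (simp_all add: measurable_cong_sets[OF sets\<nu> refl])
    also have "\<dots> = (\<Sum>j\<le>n. - \<beta> j / 2 * lump n (\<lambda>k. measure \<nu> (c -` {k})) j)"
      using integral_lumped_cells[OF \<nu>.prob_space_axioms c\<nu>, of "\<lambda>i. - \<beta> i / 2" n] by (simp add: space m_def)
    finally show ?thesis by (simp add: sum_divide_distrib sum_negf)
  qed
  have "K * ((LINT x|\<mu>'. g x) - (LINT x|\<nu>. f x)) \<le> (LINT x|\<nu>. \<rho> x * ln (\<rho> x))"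
    unfolding \<mu>'_def by (rule PL_dual_entropy[OF \<nu> PL K \<rho> \<mu> ent f_meas f_bd g_meas g_bd fg])
  then show ?thesis
    unfolding \<mu>'_def[symmetric] int_g int_f using K by (simp add: field_simps)
qed

text \<open>
  For each \<open>\<epsilon>\<close>, cut the space into blocks and solve the discrete problem with the squared essential
  distances as cost; the dual bound holds because one null set can be removed that makes every
  essential distance a true lower bound. Then let \<open>\<epsilon> \<rightarrow> 0\<close>.
\<close>

lemma PL_transport_cost_le_entropy:
  fixes \<nu> :: "'a::metric_space measure" and \<rho> :: "'a \<Rightarrow> real"
  assumes \<nu>: "borel_prob \<nu>" and PL: "PL K \<nu>" and K: "0 < K"
    and \<rho>: "\<rho> \<in> borel_measurable borel" "\<And>x. 0 \<le> \<rho> x"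
    and \<mu>: "prob_space (density \<nu> \<rho>)"
    and ent: "integrable \<nu> (\<lambda>x. \<rho> x * ln (\<rho> x))"
  shows "transport_cost (density \<nu> \<rho>) \<nu> \<le> ennreal (2 / K * (LINT x|\<nu>. \<rho> x * ln (\<rho> x)))"
proof -
  define V where "V = 2 / K * (LINT x|\<nu>. \<rho> x * ln (\<rho> x))"
  define \<mu>' where "\<mu>' = density \<nu> \<rho>"
  interpret \<nu>: prob_space \<nu> using \<nu> by (simp add: borel_prob_def)
  interpret \<mu>: prob_space \<mu>' using \<mu> by (simp add: \<mu>'_def)
  have sets\<nu>: "sets \<nu> = sets borel" using \<nu> by (simp add: borel_prob_def)
  then have sets\<mu>: "sets \<mu>' = sets borel" by (simp add: \<mu>'_def)
  have bp: "borel_prob \<mu>'" using sets\<mu> \<mu>.prob_space_axioms by (simp add: borel_prob_def)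
  have space: "space \<nu> = UNIV" "space \<mu>' = UNIV"
    using sets_eq_imp_space_eq[OF sets\<mu>] sets_eq_imp_space_eq[OF sets\<nu>] by auto
  have ac: "absolutely_continuous \<nu> \<mu>'" unfolding \<mu>'_def
    using \<rho> by (intro absolutely_continuousI_density)
      (simp add: measurable_cong_sets[OF sets\<nu> refl])
  have approx: "transport_cost \<mu>' \<nu> \<le> ennreal ((1 + \<epsilon>) * V + 4 * \<epsilon>\<^sup>2 + 4 * \<epsilon>)" if \<epsilon>: "0 < \<epsilon>" for \<epsilon>
  proof -
    obtain c :: "'a \<Rightarrow> nat" and N where c: "c \<in> measurable borel (count_space UNIV)"
      and N: "N \<in> null_sets \<nu>" and block: "\<And>n. block \<nu> \<epsilon> (c -` {n} - N)"
      using PL_block_partition[OF \<nu> PL less_imp_le[OF K] \<epsilon>] by blast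
    define A where "A i = c -` {i} - N" for i
    define D where "D i j = ess_dist \<nu> (A i) (A j)" for i j
    have A: "A i \<in> sets \<nu>" for i using block[of i] by (auto simp: block_def A_def)
    have D0: "0 \<le> D i j" for i j unfolding D_def by (rule ess_dist_nonneg[OF sets\<nu> A A])
    have "\<forall>ij. \<exists>M. M \<in> null_sets \<nu> \<and>
        (\<forall>x\<in>A (fst ij) - M. \<forall>y\<in>A (snd ij) - M. D (fst ij) (snd ij) \<le> dist x y)"
      using ess_dist_attained[OF sets\<nu> A A] unfolding D_def by blast
    then obtain M where "\<forall>ij. M ij \<in> null_sets \<nu> \<and>
        (\<forall>x\<in>A (fst ij) - M ij. \<forall>y\<in>A (snd ij) - M ij. D (fst ij) (snd ij) \<le> dist x y)"
      by (rule choice[THEN exE])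
    then have M: "M ij \<in> null_sets \<nu>"
        "\<And>x y. x \<in> A (fst ij) - M ij \<Longrightarrow> y \<in> A (snd ij) - M ij \<Longrightarrow> D (fst ij) (snd ij) \<le> dist x y" for ij
      by blast+
    define N' where "N' = N \<union> (\<Union>ij. M ij)"
    have N': "N' \<in> null_sets \<nu>" unfolding N'_def using N M(1) by (intro null_sets.Un null_sets_UN')  auto
    have D_le: "(D i j)\<^sup>2 \<le> (dist x y)\<^sup>2" if "x \<in> c -` {i} - N'" "y \<in> c -` {j} - N'" for i j x y
      using M(2)[of x "(i, j)" y] that D0[of i j] by (intro power_mono) (auto simp: N'_def A_def)
    have c\<nu>: "c \<in> measurable \<nu> (count_space UNIV)" and c\<mu>: "c \<in> measurable \<mu>' (count_space UNIV)"
      using c by (simp_all add: measurable_cong_sets[OF sets\<nu> refl] measurable_cong_sets[OF sets\<mu> refl])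
    have p: "(\<lambda>k. measure \<mu>' (c -` {k})) sums 1"
      using cell_probabilities_sum[OF \<mu>.prob_space_axioms c\<mu>] by (simp add: space)
    have q: "(\<lambda>k. measure \<nu> (c -` {k})) sums 1"
      using cell_probabilities_sum[OF \<nu>.prob_space_axioms c\<nu>] by (simp add: space)
    obtain w where w: "\<And>i j. 0 \<le> w i j" "\<And>i. (\<lambda>j. w i j) sums measure \<mu>' (c -` {i})"
      "\<And>j. (\<lambda>i. w i j) sums measure \<nu> (c -` {j})"
      "\<And>n. (\<Sum>i<n. \<Sum>j<n. (D i j)\<^sup>2 * w i j) \<le> V"
    proof (rule countable_transport_duality[OF _ _ p _ q])
      fix n and \<alpha> \<beta> :: "nat \<Rightarrow> real"
      assume feasible: "\<And>i j. i \<le> n \<Longrightarrow> j \<le> n \<Longrightarrow>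
        \<alpha> i + \<beta> j \<le> (if i < n \<and> j < n then (D i j)\<^sup>2 else 0)"
      show "(\<Sum>i\<le>n. \<alpha> i * lump n (\<lambda>k. measure \<mu>' (c -` {k})) i)
          + (\<Sum>j\<le>n. \<beta> j * lump n (\<lambda>k. measure \<nu> (c -` {k})) j) \<le> V"
        unfolding V_def \<mu>'_def
        by (rule cell_potentials_le_entropy[OF \<nu> PL K \<rho> \<mu> ent c N' D_le feasible])
    qed auto
    show ?thesis
      by (rule transport_cost_le_of_plan[OF bp \<nu> ac c N block \<epsilon> w(1-3)])
        (use w(4) in \<open>simp add: D_def A_def\<close>)
  qed
  have "((\<lambda>\<epsilon>. ennreal ((1 + \<epsilon>) * V + 4 * \<epsilon>\<^sup>2 + 4 * \<epsilon>)) \<longlongrightarrow> ennreal ((1 + 0) * V + 4 * 0\<^sup>2 + 4 * 0)) (at_right 0)"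
    by (intro tendsto_ennrealI tendsto_intros)
  then have "transport_cost \<mu>' \<nu> \<le> ennreal ((1 + 0) * V + 4 * 0\<^sup>2 + 4 * 0)"
    by (rule tendsto_lowerbound)
      (auto simp: eventually_at_right_less intro!: eventually_mono[OF eventually_at_right_less] approx)
  then show ?thesis by (simp add: V_def \<mu>'_def)
qed

theorem theorem2p12:
  fixes \<nu> :: "'a::metric_space measure" and K :: real
  assumes "measured_length_space \<nu>"
    and "K > 0"
    and "PL K \<nu>"
  shows "\<forall>\<mu>\<in>P2. enn2ereal ((W2 \<mu> \<nu>)\<^sup>2) \<le> ereal (2 / K) * relative_entropy \<nu> \<mu>"
proof
  fix \<mu> :: "'a measure" assume "\<mu> \<in> P2"
  then have \<mu>: "borel_prob \<mu>" by (simp add: P2_def)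
  have \<nu>: "borel_prob \<nu>" using assms(1) by (simp add: measured_length_space_def)
  interpret \<nu>: prob_space \<nu> using \<nu> by (simp add: borel_prob_def)
  interpret \<mu>: prob_space \<mu> using \<mu> by (simp add: borel_prob_def)
  have sets\<nu>: "sets \<nu> = sets borel" and sets\<mu>: "sets \<mu> = sets borel"
    using \<mu> \<nu> by (simp_all add: borel_prob_def)
  show "enn2ereal ((W2 \<mu> \<nu>)\<^sup>2) \<le> ereal (2 / K) * relative_entropy \<nu> \<mu>"
  proof (cases "absolutely_continuous \<nu> \<mu>")
    case False
    then show ?thesis using \<open>K > 0\<close> by (simp add: relative_entropy_def)
  next
    case True
    define \<rho> where "\<rho> x = enn2real (RN_deriv \<nu> \<mu> x)" for x
    define h where "h x = \<rho> x * ln (\<rho> x)" for x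
    define a where "a = (\<integral>\<^sup>+x. ennreal (h x) \<partial>\<nu>)"
    define b where "b = (\<integral>\<^sup>+x. ennreal (- h x) \<partial>\<nu>)"
    have ent: "relative_entropy \<nu> \<mu> = enn2ereal a - enn2ereal b"
      using True by (simp add: relative_entropy_def a_def b_def h_def \<rho>_def Let_def)
    have "\<rho> \<in> borel_measurable \<nu>" unfolding \<rho>_def by measurable
    then have \<rho>: "\<rho> \<in> borel_measurable borel" "\<And>x. 0 \<le> \<rho> x"
      by (auto simp: \<rho>_def measurable_cong_sets[OF sets\<nu> refl])
    have h_meas[measurable]: "h \<in> borel_measurable \<nu>"
      using \<rho>(1) unfolding h_def by (simp add: measurable_cong_sets[OF sets\<nu> refl])
    have "density \<nu> \<rho> = \<mu>"
    proof -
      have "AE x in \<nu>. RN_deriv \<nu> \<mu> x \<noteq> \<infinity>"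
        using True sets\<mu> sets\<nu> by (intro \<nu>.RN_deriv_finite \<mu>.sigma_finite_measure_axioms) auto
      then have "density \<nu> \<rho> = density \<nu> (RN_deriv \<nu> \<mu>)"
        unfolding \<rho>_def by (intro density_cong) (auto elim!: eventually_mono simp: less_top)
      also have "\<dots> = \<mu>" using True sets\<mu> sets\<nu> by (intro \<nu>.density_RN_deriv) auto
      finally show ?thesis .
    qed
    \<comment> \<open>the negative part of the entropy is always finite\<close>
    have "- h x \<le> 1" for x
    proof (cases "\<rho> x = 0")
      case False
      then have "0 < \<rho> x" using \<rho>(2)[of x] by simp
      then have "ln (1 / \<rho> x) \<le> 1 / \<rho> x - 1" by (intro ln_le_minus_one) simp
      then have "\<rho> x * (- ln (\<rho> x)) \<le> \<rho> x * (1 / \<rho> x)"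
        using \<open>0 < \<rho> x\<close> by (intro mult_left_mono) (auto simp: ln_div)
      then show ?thesis using \<open>0 < \<rho> x\<close> by (simp add: h_def)
    qed (simp add: h_def)
    then have "b \<le> (\<integral>\<^sup>+x. 1 \<partial>\<nu>)"
      unfolding b_def by (intro nn_integral_mono) (simp add: ennreal_le_1)
    then have b: "b < \<infinity>" using \<nu>.emeasure_space_1 by (auto intro: le_less_trans)
    show ?thesis
    proof (cases "a = \<infinity>")
      case True
      then have "relative_entropy \<nu> \<mu> = \<infinity>" using b unfolding ent by (cases b) auto
      then show ?thesis using \<open>K > 0\<close> by simp
    next
      case False
      then have fin: "a < \<infinity>" by (simp add: less_top)
      have int: "integrable \<nu> h"
        using fin b by (simp add: real_integrable_def a_def b_def less_top)
      have "(LINT x|\<nu>. h x) = enn2real a - enn2real b"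
        unfolding a_def b_def by (rule real_lebesgue_integral_def[OF int])
      then have H: "relative_entropy \<nu> \<mu> = ereal (LINT x|\<nu>. h x)"
        unfolding ent using fin b by (cases a; cases b) auto
      have cost: "transport_cost \<mu> \<nu> \<le> ennreal (2 / K * (LINT x|\<nu>. h x))"
        using PL_transport_cost_le_entropy[OF \<nu> assms(3,2) \<rho>] \<mu>.prob_space_axioms int
        by (simp add: \<open>density \<nu> \<rho> = \<mu>\<close> h_def[abs_def])
      have "prob_space (density \<nu> \<rho>)"
        using \<mu>.prob_space_axioms by (simp add: \<open>density \<nu> \<rho> = \<mu>\<close>)
      then have "0 \<le> (LINT x|\<nu>. h x)"
        using donsker_varadhan[of \<nu> \<rho> "\<lambda>_. 0" 0 0] \<nu>.prob_space_axioms \<rho>(2) \<open>\<rho> \<in> borel_measurable \<nu>\<close>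
          int[unfolded h_def] \<nu>.prob_space
        by (simp add: h_def)
      then have "enn2ereal (transport_cost \<mu> \<nu>) \<le> ereal (2 / K * (LINT x|\<nu>. h x))"
        using cost \<open>K > 0\<close> by (metis enn2ereal_ennreal less_eq_ennreal.rep_eq
          divide_nonneg_pos mult_nonneg_nonneg zero_le_numeral)
      then show ?thesis by (simp add: W2_squared H)
    qed
  qed
qed

end
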